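(* Fix $p$ with $1<p\le\infty$. Let $\{\omega^t\}_{t\in[0,1]}$ be a family of weights on $\mathbb{T}$ with $\omega^t\in RH_p^d(\mathbb{T})$ for every $t$, such that (i) the mapping $t\mapsto\omega^t$ is measurable (i.e. $(t,x)\mapsto\omega^t(x)$ is jointly measurable); (ii) $\displaystyle\int_0^1\!\!\int_0^1 \big|\log\omega^t(x)\big|\,dx\,dt<\infty$; (iii$'$) there is a constant $V$ with $RH_p^d(\omega^t)\le V$ for all $t\in[0,1]$. Then $\Omega(x)=\exp\{\int_0^1\log\omega^t(x+t)\,dt\}$ belongs to $RH_p(\mathbb{T})$, and $RH_p(\Omega)$ is bounded by a constant depending only on $p$ and $V$.
   Context: $\mathbb{T}$ is the circle obtained by identifying the endpoints of $[0,1]$; $x+t$ means $x+t\bmod 1$. Dyadic intervals: $\mathcal{D}=\{[0,1]\}\cup\{[j2^{-k},(j+1)2^{-k}) : k\in\mathbb{N},0\le j\le 2^k-1\}$. $-\!\!\!\!\!\!\int_E f=\frac1{|E|}\int_Ef$. A weight is a nonnegative locally integrable function. For $1<p<\infty$, $RH_p(\omega)=\sup_Q\big(-\!\!\!\!\!\!\int_Q\omega^p\big)^{1/p}\big(-\!\!\!\!\!\!\int_Q\omega\big)^{-1}$, and $RH_\infty(\omega)=\sup_Q(\operatorname{ess\,sup}_Q\omega)\big(-\!\!\!\!\!\!\int_Q\omega\big)^{-1}$, suprema over all intervals $Q\subset\mathbb{T}$; $\omega\in RH_p$ iff finite. A weight $\omega$ is dyadic doubling with constant $C$ if $\int_{\widetilde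 I}\omega\le C\int_I\omega$ for all $I\in\mathcal{D}$, where $\widetilde I$ is the unique dyadic interval of length $2|I|$ containing $I$. $\omega\in RH_p^d$ if the analogous supremum over dyadic intervals only is finite and $\omega$ is dyadic doubling; $RH_p^d(\omega)$ is the larger of this dyadic supremum and the dyadic doubling constant. *)

theory Defs
  imports "HOL-Analysis.Analysis"
begin

text \<open>The circle T is modelled by [0,1); addition mod 1 is x + t taken through frac.
  Functions on T are real functions of which only the values on [0,1) matter.\<close>

definition avg :: "real set \<Rightarrow> (real \<Rightarrow> real) \<Rightarrow> real" where
  "avg E f = (LINT x:E|lebesgue. f x) / measure lebesgue E"

definition weight :: "(real \<Rightarrow> real) \<Rightarrow> bool" where
  "weight w \<longleftrightarrow> (\<forall>x\<in>{0..<1}. 0 \<le> w x) \<and> set_integrable lebesgue {0..<1} w"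

text \<open>Arcs (intervals) of T: starting point a in [0,1), length l in (0,1]; wrap-around allowed.\<close>
definition arc :: "real \<Rightarrow> real \<Rightarrow> real set" where
  "arc a l = {x\<in>{0..<1}. frac (x - a) < l}"

definition dyadic :: "nat \<Rightarrow> nat \<Rightarrow> real set" where
  "dyadic k j = {real j / 2^k ..< (real j + 1) / 2^k}"

definition rh_ineq :: "ereal \<Rightarrow> real set \<Rightarrow> (real \<Rightarrow> real) \<Rightarrow> real \<Rightarrow> bool" where
  "rh_ineq p Q w C =
     (if p = \<infinity> then (AE x in lebesgue. x \<in> Q \<longrightarrow> w x \<le> C * avg Q w)
      else set_integrable lebesgue Q (\<lambda>x. w x powr real_of_ereal p) \<and>
           avg Q (\<lambda>x. w x powr real_of_ereal p) powr (1 / real_of_ereal p) \<le> C * avg Q w)"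

definition RH_le :: "ereal \<Rightarrow> (real \<Rightarrow> real) \<Rightarrow> real \<Rightarrow> bool" where
  "RH_le p w C \<longleftrightarrow> weight w \<and> (\<forall>a\<in>{0..<1}. \<forall>l\<in>{0<..1}. rh_ineq p (arc a l) w C)"

text \<open>w \<in> RH_p^d(T) with RH_p^d(w) \<le> C (dyadic RH supremum and dyadic doubling constant both \<le> C).\<close>
definition RHd_le :: "ereal \<Rightarrow> (real \<Rightarrow> real) \<Rightarrow> real \<Rightarrow> bool" where
  "RHd_le p w C \<longleftrightarrow> weight w \<and>
     rh_ineq p {0..1} w C \<and>
     (\<forall>k j. j < 2^k \<longrightarrow> rh_ineq p (dyadic k j) w C) \<and>
     (\<forall>k j. 0 < k \<longrightarrow> j < 2^k \<longrightarrow>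
        (LINT x:dyadic (k - 1) (j div 2)|lebesgue. w x) \<le> C * (LINT x:dyadic k j|lebesgue. w x))"

end

theory Submission
  imports Defs
begin

text \<open>
  For a dyadic reverse Hoelder weight \<open>v\<close>, a stopping-time argument bounds the mean of
  \<open>ln\<^sup>+ (v\<^sub>I / v)\<close> over every dyadic \<open>I\<close>, where \<open>v\<^sub>I\<close> is the average of \<open>v\<close>.
  An arc of length about \<open>2\<^sup>-\<^sup>n\<close> lies in two neighbouring dyadic intervals of that length, whose
  averages differ at most by a factor exponential in the number \<open>k\<close> of generations up to their
  common ancestor. Hence the \<open>L\<^sup>p\<close> mean of \<open>v\<close> over the arc is at most
  \<open>exp (c + C + A k)\<close>, \<open>c\<close> being the mean of \<open>ln v\<close> over the arc. For \<open>v = \<omega>\<^sup>t\<close> and the arc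
  rotated by \<open>t\<close>, the integral of \<open>k = k(t)\<close> over \<open>t\<close> is at most \<open>2\<close>, although
  that of \<open>exp (A k)\<close> need not be bounded. So one moves \<open>c + C + A k\<close> into the logarithm before
  applying Jensen's inequality in \<open>t\<close>. The remaining factor \<open>exp (\<integral> c dt)\<close> is the
  geometric mean of \<open>\<Omega>\<close> over the arc, hence at most its average.
\<close>

subsection \<open>Dyadic intervals and differentiation\<close>

text \<open>Reverse Hoelder and doubling are each used twice. Reverse Hoelder makes a subset of
  small proportion \<open>\<eta>\<close> carry at most half of the mass, which drives the
  stopping-time argument, and it bounds the L^p means over the two covering intervals. Doubling
  keeps the average over a stopped interval comparable to that of its unstopped parent, and it
  limits the change of \<open>ln\<close> of the average to \<open>ln V\<close> per generation. The
  obstacle is a pair of neighbours separated by a dyadic point of low generation. A proportion of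
  about 2^-k of the rotations meets a pair k generations below its common ancestor, at a loss of exp
  (A k). Here A = 6 ln V and V \<ge> 2, so exp A \<ge> 64 and the sum of 2^-k exp (A k) grows with
  n, while the sum of 2^-k k does not: only an estimate linear in k survives the integration over t.
  As \<open>\<omega>\<close> is only Lebesgue measurable on the square, the work is done for a
  strictly positive Borel function equal to it almost everywhere, and the result is carried
  back.\<close>

lemma mem_dyadic_iff: "x \<in> dyadic n j \<longleftrightarrow> \<lfloor>x * 2 ^ n\<rfloor> = int j"
  by (auto simp: dyadic_def floor_eq_iff field_simps)

lemma dyadic_ancestor:
  assumes "x \<in> dyadic n j" "k \<le> n"
  shows "x \<in> dyadic k (j div 2 ^ (n - k))"
proof -
  have "\<lfloor>x * 2 ^ k\<rfloor> = \<lfloor>x * 2 ^ n / real_of_int (2 ^ (n - k))\<rfloor>"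
    using assms(2) power_add[of "2::real" k "n - k"] by simp
  also have "\<dots> = \<lfloor>x * 2 ^ n\<rfloor> div 2 ^ (n - k)"
    by (rule floor_divide_real_eq_div) simp
  finally show ?thesis
    using assms(1) by (simp add: mem_dyadic_iff zdiv_int)
qed

lemma dyadic_mem_unique: "x \<in> dyadic n i \<Longrightarrow> x \<in> dyadic n j \<Longrightarrow> i = j"
  by (simp add: mem_dyadic_iff)

lemma dyadic_parent: "dyadic (Suc n) j \<subseteq> dyadic n (j div 2)"
  using dyadic_ancestor[of _ "Suc n" j n] by (auto simp: Suc_diff_le)

lemma dyadic_subset_unit:
  assumes "j < 2 ^ n"
  shows "dyadic n j \<subseteq> {0..<1}"
proof
  fix x assume x: "x \<in> dyadic n j"
  have "real j + 1 \<le> 2 ^ n"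
    using assms by (metis Suc_eq_plus1 Suc_leI of_nat_1 of_nat_add of_nat_le_iff of_nat_numeral of_nat_power)
  then have "(real j + 1) / 2 ^ n \<le> 1" by simp
  then have "x < 1" using x unfolding dyadic_def by (meson atLeastLessThan_iff order_less_le_trans)
  moreover have "0 \<le> x" using x unfolding dyadic_def
    by (meson atLeastLessThan_iff divide_nonneg_nonneg of_nat_0_le_iff order_trans zero_le_numeral zero_le_power)
  ultimately show "x \<in> {0..<1}" by simp
qed

lemma ex_dyadic_mem:
  assumes "x \<in> {0..<1}"
  obtains j where "j < 2 ^ n" "x \<in> dyadic n j"
proof
  show "x \<in> dyadic n (nat \<lfloor>x * 2 ^ n\<rfloor>)" using assms by (simp add: mem_dyadic_iff)
  have "x * 2 ^ n < 1 * 2 ^ n" using assms by (intro mult_strict_right_mono) auto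
  then have "\<lfloor>x * 2 ^ n\<rfloor> < 2 ^ n" by (simp add: floor_less_iff)
  then show "nat \<lfloor>x * 2 ^ n\<rfloor> < 2 ^ n" using assms by (simp add: nat_less_iff)
qed

lemma dyadic_sets [measurable, simp]: "dyadic n j \<in> sets borel"
  by (simp add: dyadic_def)

lemma emeasure_dyadic: "emeasure lborel (dyadic n j) = ennreal (1 / 2 ^ n)"
  by (simp add: dyadic_def divide_simps)

lemma measure_dyadic [simp]: "measure lborel (dyadic n j) = 1 / 2 ^ n"
  by (simp add: measure_def emeasure_dyadic)

text \<open>One-sided Lebesgue differentiation from the library, applied to \<open>v\<close> and to its reflection.\<close>

lemma AE_ge_of_dyadic_averages:
  fixes v :: "real \<Rightarrow> real"
  assumes int: "set_integrable lborel {0..<1} v"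
  shows "AE x in lborel. \<forall>c k j. x \<in> dyadic k j \<longrightarrow> j < 2 ^ k \<longrightarrow>
     (\<forall>n i. k \<le> n \<longrightarrow> i < 2 ^ n \<longrightarrow> x \<in> dyadic n i \<longrightarrow> c / 2 ^ n \<le> (LINT y:dyadic n i|lborel. v y)) \<longrightarrow> c \<le> v x"
proof -
  define f where "f = (\<lambda>x. indicat_real {0..<1} x * v x)"
  have f: "integrable lborel f"
    using int by (simp add: f_def set_integrable_def)
  have fm: "integrable lborel (\<lambda>x. f (- x))"
    using lborel_integrable_real_affine[OF f, of "-1" 0] by simp
  have ion: "g integrable_on cbox a b" if "integrable lborel g" for g :: "real \<Rightarrow> real" and a b
    using integrable_on_lborel[OF that] integrable_on_subcbox by blast
  obtain N1 where N1: "negligible N1" "\<And>x e. \<lbrakk>x \<notin> N1; 0 < e\<rbrakk> \<Longrightarrow>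
      \<exists>d>0. \<forall>h. 0 < h \<and> h < d \<longrightarrow> norm (integral (cbox x (x + h *\<^sub>R One)) f /\<^sub>R h ^ DIM(real) - f x) < e"
    using integrable_ccontinuous_explicit[of f] ion[OF f] by blast
  obtain N2 where N2: "negligible N2" "\<And>x e. \<lbrakk>x \<notin> N2; 0 < e\<rbrakk> \<Longrightarrow>
      \<exists>d>0. \<forall>h. 0 < h \<and> h < d \<longrightarrow>
        norm (integral (cbox x (x + h *\<^sub>R One)) (\<lambda>x. f (- x)) /\<^sub>R h ^ DIM(real) - f (- x)) < e"
    using integrable_ccontinuous_explicit[of "\<lambda>x. f (- x)"] ion[OF fm] by blast
  have "negligible (uminus ` N2)"
    by (intro negligible_differentiable_image_negligible) (auto simp: N2 intro!: derivative_intros)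
  then have "negligible (N1 \<union> uminus ` N2)" using N1 by (simp add: negligible_Un)
  then have "N1 \<union> uminus ` N2 \<in> null_sets lebesgue" by (simp add: negligible_iff_null_sets)
  then have "AE x in lebesgue. x \<notin> N1 \<union> uminus ` N2" by (rule AE_not_in)
  then have AE: "AE x in lborel. x \<notin> N1 \<union> uminus ` N2" by (simp add: AE_completion_iff)
  \<comment> \<open>One null set serves all \<open>c\<close>, \<open>k\<close> and \<open>j\<close>,
    so these can be quantified inside the almost-everywhere statement.\<close>
  show ?thesis
    using AE
  proof (rule eventually_mono, intro allI impI)
    fix x c k j
    assume x: "x \<notin> N1 \<union> uminus ` N2" and xJ: "x \<in> dyadic k j" "j < 2 ^ k"
      and avg: "\<forall>n i. k \<le> n \<longrightarrow> i < 2 ^ n \<longrightarrow> x \<in> dyadic n i \<longrightarrow> c / 2 ^ n \<le> (LINT y:dyadic n i|lborel. v y)"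
    show "c \<le> v x"
    proof (rule ccontr)
      assume "\<not> c \<le> v x"
      have x01: "x \<in> {0..<1}" using xJ dyadic_subset_unit by blast
      then have fx: "f x = v x" by (simp add: f_def)
      define e where "e = (c - v x) / 2"
      have "e > 0" using \<open>\<not> c \<le> v x\<close> by (simp add: e_def)
      have xm: "- x \<notin> N2" using x by force
      obtain d1 where d1: "d1 > 0" "\<And>h. 0 < h \<Longrightarrow> h < d1 \<Longrightarrow> \<bar>integral {x..x + h} f / h - v x\<bar> < e"
        using N1(2)[of x e] x \<open>e > 0\<close> by (auto simp: fx divide_inverse mult.commute)
      obtain d2 where d2: "d2 > 0"
        "\<And>h. 0 < h \<Longrightarrow> h < d2 \<Longrightarrow> \<bar>integral {- x..- x + h} (\<lambda>x. f (- x)) / h - v x\<bar> < e"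
        using N2(2)[OF xm \<open>e > 0\<close>] by (auto simp: fx divide_inverse mult.commute)
      have right: "integral {x..b} f \<le> (v x + e) * (b - x)" if "x \<le> b" "b < x + d1" for b
      proof (cases "b = x")
        case False
        then have "integral {x..b} f / (b - x) - v x < e"
          using d1(2)[of "b - x"] that by auto
        then show ?thesis using False that by (simp add: field_simps)
      qed simp
      have left: "integral {a..x} f \<le> (v x + e) * (x - a)" if "a \<le> x" "x < a + d2" for a
      proof (cases "a = x")
        case False
        have "integral {- x..- a} (\<lambda>x. f (- x)) = integral {a..x} f"
          using Henstock_Kurzweil_Integration.integral_reflect_real[of x a f] by simp
        then have "integral {a..x} f / (x - a) - v x < e"
          using d2(2)[of "x - a"] False that by auto
        then show ?thesis using False that by (simp add: field_simps)
      qed simp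
      \<comment> \<open>The dyadic interval around \<open>x\<close> is taken shorter than both radii
        and of generation at least \<open>k\<close>. Split at \<open>x\<close>, its integral is at
        most \<open>v x + e\<close> times its length; as \<open>v x + e < c\<close>, this
        contradicts the assumed lower bound.\<close>
      obtain n0 where n0: "(1/2) ^ n0 < min d1 d2"
        using real_arch_pow_inv[of "min d1 d2" "1/2"] d1 d2 by auto
      define n where "n = max n0 k"
      have "(1/2::real) ^ n \<le> (1/2) ^ n0" by (rule power_decreasing) (auto simp: n_def)
      then have n: "1 / 2 ^ n < min d1 d2" using n0 by (simp add: power_one_over)
      obtain i where i: "i < 2 ^ n" "x \<in> dyadic n i" using ex_dyadic_mem[OF x01] by blast
      define a where "a = real i / 2 ^ n"
      define b where "b = (real i + 1) / 2 ^ n"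
      have ab: "a \<le> x" "x < b" "b - a = 1 / 2 ^ n"
        using i by (auto simp: a_def b_def dyadic_def diff_divide_distrib[symmetric])
      have "c / 2 ^ n \<le> (LINT y:dyadic n i|lborel. v y)"
        using avg i by (simp add: n_def)
      also have "\<dots> = (LINT y:{a..b}|lborel. f y)"
        unfolding set_lebesgue_integral_def
      proof (rule integral_cong_AE)
        have sub: "dyadic n i \<subseteq> {0..<1}" using dyadic_subset_unit i by blast
        have eq: "indicator (dyadic n i) y *\<^sub>R v y = indicat_real (dyadic n i) y *\<^sub>R f y" for y
          using sub by (auto simp: f_def indicator_def)
        show "(\<lambda>y. indicator (dyadic n i) y *\<^sub>R v y) \<in> borel_measurable lborel"
          unfolding eq using f by measurable
        show "(\<lambda>y. indicat_real {a..b} y *\<^sub>R f y) \<in> borel_measurable lborel"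
          using f by measurable
        show "AE y in lborel. indicator (dyadic n i) y *\<^sub>R v y = indicat_real {a..b} y *\<^sub>R f y"
          using AE_lborel_singleton[of b] unfolding eq
          by eventually_elim (auto simp: dyadic_def a_def b_def indicator_def)
      qed
      also have "\<dots> = integral {a..b} f"
        by (rule set_borel_integral_eq_integral)
           (use f in \<open>auto simp: set_integrable_def intro!: integrable_mult_indicator[where 'b=real, simplified]\<close>)
      also have "\<dots> = integral {a..x} f + integral {x..b} f"
        using ab ion[OF f, of a b] by (intro Henstock_Kurzweil_Integration.integral_combine[symmetric]) auto
      also have "\<dots> \<le> (v x + e) * (x - a) + (v x + e) * (b - x)"
        using left[of a] right[of b] ab n by auto
      also have "\<dots> = (v x + e) * (b - a)" by (simp add: algebra_simps)
      finally have "c \<le> v x + e" by (simp add: ab field_simps)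
      then show False using \<open>e > 0\<close> by (simp add: e_def field_simps)
    qed
  qed
qed

subsection \<open>The logarithmic deficit of a dyadic weight\<close>

text \<open>Adds up estimates on single stopped intervals. With \<open>\<mu>\<close> a density of
  Lebesgue measure it serves both the mass of \<open>v\<close> and the integral of the
  deficit.\<close>

lemma emeasure_UN_le_cmult:
  assumes sets: "sets \<nu> = sets \<mu>" "\<And>s. s \<in> S \<Longrightarrow> X s \<in> sets \<mu>"
    and S: "countable S" "disjoint_family_on X S"
    and le: "\<And>s. s \<in> S \<Longrightarrow> emeasure \<mu> (X s) \<le> c * emeasure \<nu> (X s)"
  shows "emeasure \<mu> (\<Union>s\<in>S. X s) \<le> c * emeasure \<nu> (\<Union>s\<in>S. X s)"
proof -
  have "emeasure \<mu> (\<Union>s\<in>S. X s) = (\<integral>\<^sup>+s. emeasure \<mu> (X s) \<partial>count_space S)"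
    using assms by (intro emeasure_UN_countable) auto
  also have "\<dots> \<le> (\<integral>\<^sup>+s. c * emeasure \<nu> (X s) \<partial>count_space S)"
    by (intro nn_integral_mono) (auto simp: le)
  also have "\<dots> = c * (\<integral>\<^sup>+s. emeasure \<nu> (X s) \<partial>count_space S)"
    by (simp add: nn_integral_cmult)
  also have "\<dots> = c * emeasure \<nu> (\<Union>s\<in>S. X s)"
    using assms by (subst emeasure_UN_countable) auto
  finally show ?thesis .
qed

lemma min_max_add_le:
  fixes a b c N :: real
  shows "a \<le> c + b \<Longrightarrow> 0 \<le> c \<Longrightarrow> min N (max 0 a) \<le> c + min N (max 0 b)"
  by (auto simp: min_def max_def)

text \<open>\<open>abs_cont\<close> is the form in which the reverse Hoelder inequality enters the
  deficit bound: quantitative absolute continuity on each dyadic interval. The exponent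
  \<open>p\<close> survives only in the size of \<open>\<eta>\<close>.\<close>

locale dyadic_weight =
  fixes v :: "real \<Rightarrow> real" and V \<eta> :: real
  assumes v_measurable [measurable]: "v \<in> borel_measurable borel"
    and v_pos: "0 < v x"
    and v_int: "set_integrable lborel {0..<1} v"
    and V_ge: "2 \<le> V" and eta: "0 < \<eta>" "\<eta> < 1"
    and doubling: "j < 2 ^ Suc k \<Longrightarrow>
      (LINT x:dyadic k (j div 2)|lborel. v x) \<le> V * (LINT x:dyadic (Suc k) j|lborel. v x)"
    and abs_cont: "\<lbrakk>j < 2 ^ k; E \<in> sets borel; E \<subseteq> dyadic k j; measure lborel E \<le> \<eta> / 2 ^ k\<rbrakk> \<Longrightarrow>
      (LINT x:E|lborel. v x) \<le> (LINT x:dyadic k j|lborel. v x) / 2"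
begin

definition mn :: "nat \<Rightarrow> nat \<Rightarrow> real" where
  "mn k j = 2 ^ k * (LINT x:dyadic k j|lborel. v x)"

lemma integral_dyadic: "(LINT x:dyadic k j|lborel. v x) = mn k j / 2 ^ k"
  by (simp add: mn_def)

lemma integrable_subset:
  assumes "E \<in> sets borel" "E \<subseteq> {0..<1}"
  shows "set_integrable lborel E v"
  using set_integrable_subset[OF v_int] assms by simp

lemma nn_integral_subset:
  assumes "E \<in> sets borel" "E \<subseteq> {0..<1}"
  shows "(\<integral>\<^sup>+x\<in>E. ennreal (v x) \<partial>lborel) = ennreal (LINT x:E|lborel. v x)"
proof -
  have "(\<integral>\<^sup>+x\<in>E. ennreal (v x) \<partial>lborel) = (\<integral>\<^sup>+x. ennreal (indicator E x *\<^sub>R v x) \<partial>lborel)"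
    by (intro nn_integral_cong) (auto simp: indicator_def)
  also have "\<dots> = ennreal (LINT x:E|lborel. v x)"
    unfolding set_lebesgue_integral_def
    using integrable_subset[OF assms] less_imp_le[OF v_pos]
    by (intro nn_integral_eq_integral) (auto simp: set_integrable_def)
  finally show ?thesis .
qed

lemma mn_pos:
  assumes "j < 2 ^ k"
  shows "0 < mn k j"
proof (rule ccontr)
  assume "\<not> 0 < mn k j"
  then have "(LINT x:dyadic k j|lborel. v x) \<le> 0"
    by (simp add: mn_def zero_less_mult_iff not_less)
  then have "(\<integral>\<^sup>+x\<in>dyadic k j. ennreal (v x) \<partial>lborel) = 0"
    using nn_integral_subset[OF dyadic_sets dyadic_subset_unit[OF assms]] by (simp add: ennreal_neg)
  then have "AE x in lborel. ennreal (v x) * indicator (dyadic k j) x = 0"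
    by (subst (asm) nn_integral_0_iff_AE) auto
  then have "AE x in lborel. x \<notin> dyadic k j"
    by eventually_elim (use v_pos in \<open>auto simp: indicator_def ennreal_eq_0_iff simp flip: not_less split: if_splits\<close>)
  then have "emeasure lborel (dyadic k j) = 0"
    by (subst (asm) AE_iff_measurable[where N="dyadic k j"]) auto
  moreover have "(0::real) < 1 / 2 ^ k" by simp
  ultimately show False unfolding emeasure_dyadic by (metis ennreal_eq_0_iff not_le)
qed

lemma mn_parent:
  assumes "j < 2 ^ Suc k"
  shows "2 * mn k (j div 2) \<le> V * mn (Suc k) j" "mn (Suc k) j \<le> 2 * mn k (j div 2)"
proof -
  show "2 * mn k (j div 2) \<le> V * mn (Suc k) j"
    using doubling[OF assms] by (simp add: integral_dyadic field_simps)
  have "j div 2 < 2 ^ k" using assms by auto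
  then have sub: "dyadic k (j div 2) \<subseteq> {0..<1}" by (rule dyadic_subset_unit)
  have "(LINT x:dyadic (Suc k) j|lborel. v x) \<le> (LINT x:dyadic k (j div 2)|lborel. v x)"
    unfolding set_lebesgue_integral_def
    using dyadic_parent[of k j] less_imp_le[OF v_pos] sub
      integrable_subset[of "dyadic k (j div 2)"] integrable_subset[of "dyadic (Suc k) j"]
    by (intro integral_mono) (auto simp: set_integrable_def indicator_def)
  then show "mn (Suc k) j \<le> 2 * mn k (j div 2)" by (simp add: integral_dyadic field_simps)
qed

text \<open>Subadditivity of the truncated logarithmic deficit under the stopping rule
  ``the average drops below a quarter''. The stopped intervals cover at most the proportion
  \<open>1 - \<eta>\<close>, which makes the supremum over all intervals finite independently of the truncation.\<close>

lemma truncated_deficit_step: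
  assumes N: "0 \<le> N" and \<beta>: "0 \<le> \<beta>"
    and IH: "\<And>k j. j < 2 ^ k \<Longrightarrow>
      (\<integral>\<^sup>+x\<in>dyadic k j. ennreal (min N (max 0 (ln (mn k j / v x)))) \<partial>lborel) \<le> ennreal (\<beta> / 2 ^ k)"
    and j0: "j0 < 2 ^ k"
  shows "(\<integral>\<^sup>+x\<in>dyadic k j0. ennreal (min N (max 0 (ln (mn k j0 / v x)))) \<partial>lborel)
     \<le> ennreal ((ln (8 * V) + (1 - \<eta>) * \<beta>) / 2 ^ k)"
proof -
  define W where "W k j x = ennreal (min N (max 0 (ln (mn k j / v x))))" for k j x
  have W_measurable [measurable]: "W k j \<in> borel_measurable borel" for k j
    unfolding W_def by measurable
  \<comment> \<open>With a quarter as threshold, the stopped intervals carry at most a quarter of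
    the mass of \<open>I\<close>. The rest carries more than half, so by the contrapositive of
    \<open>abs_cont\<close> its proportion exceeds \<open>\<eta>\<close>.\<close>
  define l where "l = mn k j0 / 4"
  have l: "l > 0" using mn_pos[OF j0] by (simp add: l_def)
  define I where "I = dyadic k j0"
  \<comment> \<open>The maximal dyadic subintervals of \<open>I\<close> with average at most
    \<open>l\<close>: every larger one up to \<open>I\<close> itself must lie above the threshold.
    This yields disjointness and, through the parent, a lower bound for the stopped average.\<close>
  define S where "S = {(n, j). k \<le> n \<and> j < 2 ^ n \<and> j div 2 ^ (n - k) = j0 \<and> mn n j \<le> l \<and>
     (\<forall>m. k \<le> m \<and> m < n \<longrightarrow> l < mn m (j div 2 ^ (n - m)))}"
  define X where "X = (\<lambda>(n, j). dyadic n j)"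
  define D where "D = (\<Union>s\<in>S. X s)"
  have X_sets [measurable]: "X s \<in> sets borel" for s by (simp add: X_def split: prod.split)
  have S: "countable S" by simp
  have D_sets [measurable]: "D \<in> sets borel"
    unfolding D_def using S by (intro sets.countable_UN') auto
  have I_sets [measurable]: "I \<in> sets borel" by (simp add: I_def)
  have "D \<subseteq> I"
    unfolding D_def X_def I_def S_def using dyadic_ancestor by fastforce
  have I01: "I \<subseteq> {0..<1}" unfolding I_def by (rule dyadic_subset_unit[OF j0])
  have disj: "disjoint_family_on X S"
  proof -
    \<comment> \<open>If one stopped interval lay strictly inside another, the larger one would have
      an average both at most \<open>l\<close> and above \<open>l\<close>.\<close>
    have *: False if "(n, j) \<in> S" "(n', j') \<in> S" "x \<in> dyadic n j" "x \<in> dyadic n' j'" "n < n'" for n j n' j' x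
    proof -
      have "j = j' div 2 ^ (n' - n)"
        using dyadic_ancestor[OF that(4)] that(3,5) dyadic_mem_unique by auto
      then show False using that by (force simp: S_def)
    qed
    show ?thesis
      unfolding disjoint_family_on_def
    proof (intro ballI impI, rule ccontr)
      fix s t assume st: "s \<in> S" "t \<in> S" "s \<noteq> t" "X s \<inter> X t \<noteq> {}"
      obtain n j n' j' where eq: "s = (n, j)" "t = (n', j')" by fastforce
      obtain x where x: "x \<in> dyadic n j" "x \<in> dyadic n' j'"
        using st eq by (auto simp: X_def)
      have "n = n'" using *[of n j n' j' x] *[of n' j' n j x] st eq x by (metis nat_neq_iff)
      then show False using st eq x dyadic_mem_unique by blast
    qed
  qed
  have emeasure_I: "emeasure lborel I = ennreal (1 / 2 ^ k)" by (simp add: I_def emeasure_dyadic)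
  have finite_D: "emeasure lborel D \<noteq> \<infinity>" "emeasure lborel (I - D) \<noteq> \<infinity>"
    using emeasure_mono[OF \<open>D \<subseteq> I\<close>, of lborel] emeasure_mono[of "I - D" I lborel] emeasure_I
    by (auto simp: top_unique)
  have meas_split: "measure lborel D + measure lborel (I - D) = 1 / 2 ^ k"
    using measure_Union[of lborel D "I - D"] finite_D \<open>D \<subseteq> I\<close>
    by (simp add: Un_absorb1 I_def)

  have "emeasure (density lborel (\<lambda>x. ennreal (v x))) D \<le> ennreal l * emeasure lborel D"
    unfolding D_def
  proof (rule emeasure_UN_le_cmult)
    fix s assume "s \<in> S"
    then obtain n j where s: "s = (n, j)" "j < 2 ^ n" "mn n j \<le> l" by (auto simp: S_def)
    show "emeasure (density lborel (\<lambda>x. ennreal (v x))) (X s) \<le> ennreal l * emeasure lborel (X s)"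
      using s l nn_integral_subset[OF dyadic_sets dyadic_subset_unit[OF s(2)]]
      by (simp add: X_def emeasure_density emeasure_dyadic integral_dyadic ennreal_mult[symmetric]
          divide_right_mono)
  qed (use S disj in auto)
  also have "\<dots> \<le> ennreal l * emeasure lborel I"
    by (intro mult_left_mono emeasure_mono \<open>D \<subseteq> I\<close>) auto
  finally have "(LINT x:D|lborel. v x) \<le> l / 2 ^ k"
    using nn_integral_subset[of D] \<open>D \<subseteq> I\<close> I01 l
    by (simp add: emeasure_density emeasure_I ennreal_mult[symmetric])
  moreover have "(LINT x:I|lborel. v x) = (LINT x:D|lborel. v x) + (LINT x:I - D|lborel. v x)"
    using set_integral_Un[of D "I - D" lborel v] integrable_subset[of D] integrable_subset[of "I - D"]
      \<open>D \<subseteq> I\<close> I01 by (auto simp: Un_absorb1)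
  moreover have "(LINT x:I|lborel. v x) = 4 * l / 2 ^ k"
    by (simp add: I_def integral_dyadic l_def)
  ultimately have "\<not> (LINT x:I - D|lborel. v x) \<le> (LINT x:I|lborel. v x) / 2"
    using divide_pos_pos[OF l, of "2 ^ k"] by simp
  then have "\<eta> / 2 ^ k < measure lborel (I - D)"
    using abs_cont[OF j0, of "I - D"] by (intro not_le_imp_less) (auto simp: I_def)
  then have meas_D: "measure lborel D \<le> (1 - \<eta>) / 2 ^ k"
    using meas_split by (simp add: diff_divide_distrib)

  have "emeasure (density lborel (W k j0)) D \<le> ennreal (ln (2 * V) + \<beta>) * emeasure lborel D"
    unfolding D_def
  proof (rule emeasure_UN_le_cmult)
    fix s assume "s \<in> S"
    then obtain n j where s: "s = (n, j)" "k \<le> n" "j < 2 ^ n" "j div 2 ^ (n - k) = j0" "mn n j \<le> l"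
      and anc: "\<And>m. k \<le> m \<Longrightarrow> m < n \<Longrightarrow> l < mn m (j div 2 ^ (n - m))"
      by (auto simp: S_def)
    have "n \<noteq> k" using s l by (auto simp: l_def)
    then obtain m where m: "n = Suc m" "k \<le> m"
      using s(2) by (metis Suc_diff_le diff_Suc_Suc le_SucE not0_implies_Suc le_zero_eq not_less_eq_eq)
    \<comment> \<open>The parent has not stopped, so doubling keeps the stopped average above
      \<open>2 * l / V\<close>. Replacing the average over \<open>I\<close> by the stopped one in
      the logarithm thus costs at most \<open>ln (2 * V)\<close>.\<close>
    have "l < mn m (j div 2)" using anc[of m] m by simp
    then have "2 * l < V * mn n j" using mn_parent(1)[of j m] s(3) m by simp
    then have "mn k j0 < 2 * V * mn n j" by (simp add: l_def)
    then have ratio: "mn k j0 / mn n j \<le> 2 * V" using mn_pos[OF s(3)] by (simp add: field_simps)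
    have pos: "0 < mn k j0" "0 < mn n j" using mn_pos j0 s by auto
    have le: "W k j0 x \<le> ennreal (ln (2 * V)) + W n j x" for x
    proof -
      have "ln (mn k j0 / v x) = ln (mn k j0 / mn n j) + ln (mn n j / v x)"
        using pos v_pos[of x] by (simp add: ln_div)
      also have "ln (mn k j0 / mn n j) \<le> ln (2 * V)"
        using ratio pos V_ge by (subst ln_le_cancel_iff) auto
      finally have "min N (max 0 (ln (mn k j0 / v x))) \<le> ln (2 * V) + min N (max 0 (ln (mn n j / v x)))"
        using V_ge by (intro min_max_add_le) auto
      then show ?thesis
        unfolding W_def using N V_ge by (subst ennreal_plus[symmetric]) (auto intro!: ennreal_leI simp del: ennreal_plus)
    qed
    have "(\<integral>\<^sup>+x\<in>dyadic n j. W k j0 x \<partial>lborel)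
      \<le> (\<integral>\<^sup>+x. ennreal (ln (2 * V)) * indicator (dyadic n j) x + W n j x * indicator (dyadic n j) x \<partial>lborel)"
      using le by (intro nn_integral_mono) (auto simp: indicator_def)
    also have "\<dots> = ennreal (ln (2 * V)) * emeasure lborel (dyadic n j) + (\<integral>\<^sup>+x\<in>dyadic n j. W n j x \<partial>lborel)"
      by (subst nn_integral_add) (auto simp: nn_integral_cmult_indicator)
    also have "\<dots> \<le> ennreal (ln (2 * V)) * emeasure lborel (dyadic n j) + ennreal (\<beta> / 2 ^ n)"
      using IH[OF s(3)] unfolding W_def by (intro add_left_mono)
    also have "\<dots> = ennreal (ln (2 * V) + \<beta>) * emeasure lborel (dyadic n j)"
      using V_ge \<beta> by (simp add: emeasure_dyadic ennreal_mult[symmetric] ennreal_plus[symmetric]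
          add_divide_distrib[symmetric] del: ennreal_plus)
    finally show "emeasure (density lborel (W k j0)) (X s) \<le> ennreal (ln (2 * V) + \<beta>) * emeasure lborel (X s)"
      by (simp add: X_def s emeasure_density)
  qed (use S disj in auto)
  then have "(\<integral>\<^sup>+x\<in>D. W k j0 x \<partial>lborel) \<le> ennreal ((ln (2 * V) + \<beta>) * measure lborel D)"
    using finite_D V_ge \<beta> by (simp add: emeasure_density emeasure_eq_ennreal_measure ennreal_mult)
  moreover have "(\<integral>\<^sup>+x\<in>I - D. W k j0 x \<partial>lborel) \<le> ennreal (ln 4 * measure lborel (I - D))"
  proof -
    \<comment> \<open>Off \<open>D\<close> every dyadic average around \<open>x\<close> within
      \<open>I\<close> exceeds \<open>l\<close>, since the first generation where it does not would
      give a stopped interval containing \<open>x\<close>. Differentiation then gives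
      \<open>l \<le> v x\<close>, a deficit of at most \<open>ln 4\<close>.\<close>
    have "AE x in lborel. W k j0 x * indicator (I - D) x \<le> ennreal (ln 4) * indicator (I - D) x"
      using AE_ge_of_dyadic_averages[OF v_int]
    proof (rule eventually_mono)
      fix x assume diff: "\<forall>c k j. x \<in> dyadic k j \<longrightarrow> j < 2 ^ k \<longrightarrow>
        (\<forall>n i. k \<le> n \<longrightarrow> i < 2 ^ n \<longrightarrow> x \<in> dyadic n i \<longrightarrow> c / 2 ^ n \<le> (LINT y:dyadic n i|lborel. v y)) \<longrightarrow> c \<le> v x"
      show "W k j0 x * indicator (I - D) x \<le> ennreal (ln 4) * indicator (I - D) x"
      proof (cases "x \<in> I - D")
        case True
        have "l < mn n i" if ni: "k \<le> n" "i < 2 ^ n" "x \<in> dyadic n i" for n i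
        proof (rule ccontr)
          assume "\<not> l < mn n i"
          define P where "P n \<longleftrightarrow> k \<le> n \<and> (\<exists>i<2 ^ n. x \<in> dyadic n i \<and> mn n i \<le> l)" for n
          have "P n" using ni \<open>\<not> l < mn n i\<close> by (auto simp: P_def)
          then have "P (LEAST n. P n)" by (rule LeastI)
          then obtain i' where i': "i' < 2 ^ (LEAST n. P n)" "x \<in> dyadic (LEAST n. P n) i'"
            "mn (LEAST n. P n) i' \<le> l" "k \<le> (LEAST n. P n)" by (auto simp: P_def)
          have "l < mn m (i' div 2 ^ ((LEAST n. P n) - m))" if "k \<le> m" "m < (LEAST n. P n)" for m
          proof -
            have "i' < 2 ^ m * 2 ^ ((LEAST n. P n) - m)"
              using i'(1) that by (simp flip: power_add)
            then have "i' div 2 ^ ((LEAST n. P n) - m) < 2 ^ m"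
              by (simp add: div_less_iff_less_mult)
            moreover have "x \<in> dyadic m (i' div 2 ^ ((LEAST n. P n) - m))"
              using dyadic_ancestor[OF i'(2), of m] that by simp
            ultimately show ?thesis using not_less_Least[OF that(2)] that(1) by (auto simp: P_def not_le)
          qed
          moreover have "i' div 2 ^ ((LEAST n. P n) - k) = j0"
            using dyadic_ancestor[OF i'(2,4)] True dyadic_mem_unique by (auto simp: I_def)
          ultimately have "((LEAST n. P n), i') \<in> S" using i' by (auto simp: S_def)
          then have "x \<in> D" using i' by (force simp: D_def X_def)
          then show False using True by simp
        qed
        then have "l \<le> v x"
          using diff[rule_format, of k j0 l] True j0
          by (simp add: I_def integral_dyadic divide_right_mono less_imp_le)
        then have "mn k j0 / v x \<le> 4" using v_pos[of x] by (simp add: l_def field_simps)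
        then have "ln (mn k j0 / v x) \<le> ln 4" using mn_pos[OF j0] v_pos[of x] by simp
        then have "min N (max 0 (ln (mn k j0 / v x))) \<le> ln 4"
          by (simp add: max_def min_le_iff_disj)
        then show ?thesis using True by (simp add: W_def ennreal_leI)
      qed simp
    qed
    then have "(\<integral>\<^sup>+x\<in>I - D. W k j0 x \<partial>lborel) \<le> (\<integral>\<^sup>+x. ennreal (ln 4) * indicator (I - D) x \<partial>lborel)"
      by (rule nn_integral_mono_AE)
    also have "\<dots> = ennreal (ln 4 * measure lborel (I - D))"
      using finite_D by (simp add: nn_integral_cmult_indicator emeasure_eq_ennreal_measure ennreal_mult)
    finally show ?thesis .
  qed
  moreover have "(\<integral>\<^sup>+x\<in>I. W k j0 x \<partial>lborel) = (\<integral>\<^sup>+x\<in>D. W k j0 x \<partial>lborel) + (\<integral>\<^sup>+x\<in>I - D. W k j0 x \<partial>lborel)"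
    using \<open>D \<subseteq> I\<close> by (subst nn_integral_add[symmetric]) (auto intro!: nn_integral_cong simp: indicator_def)
  ultimately have "(\<integral>\<^sup>+x\<in>I. W k j0 x \<partial>lborel)
      \<le> ennreal ((ln (2 * V) + \<beta>) * measure lborel D) + ennreal (ln 4 * measure lborel (I - D))"
    by (simp add: add_mono)
  also have "\<dots> = ennreal ((ln (2 * V) + \<beta>) * measure lborel D + ln 4 * measure lborel (I - D))"
    using V_ge \<beta> by (subst ennreal_plus) auto
  \<comment> \<open>\<open>8 * V\<close> collects the factor \<open>2 * V\<close> from
    \<open>D\<close> and the factor 4 from its complement. Only \<open>\<beta>\<close> needs the
    sharper bound on the size of \<open>D\<close>: its coefficient must be below 1.\<close>
  also have "\<dots> \<le> ennreal ((ln (8 * V) + (1 - \<eta>) * \<beta>) / 2 ^ k)"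
  proof (rule ennreal_leI)
    have le: "measure lborel D \<le> 1 / 2 ^ k" "measure lborel (I - D) \<le> 1 / 2 ^ k"
      using meas_split measure_nonneg[of lborel D] measure_nonneg[of lborel "I - D"] by linarith+
    have "ln (8 * V) = ln (2 * V) + ln 4"
      using V_ge ln_mult[of "2 * V" 4] by simp
    moreover have "ln (2 * V) * measure lborel D \<le> ln (2 * V) * (1 / 2 ^ k)"
      using V_ge le by (intro mult_left_mono) auto
    moreover have "ln 4 * measure lborel (I - D) \<le> ln 4 * (1 / 2 ^ k :: real)"
      using le by (intro mult_left_mono) auto
    moreover have "\<beta> * measure lborel D \<le> \<beta> * ((1 - \<eta>) / 2 ^ k)"
      using \<beta> meas_D by (intro mult_left_mono) auto
    ultimately show "(ln (2 * V) + \<beta>) * measure lborel D + ln 4 * measure lborel (I - D)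
        \<le> (ln (8 * V) + (1 - \<eta>) * \<beta>) / 2 ^ k"
      by (simp add: algebra_simps add_divide_distrib diff_divide_distrib)
  qed
  finally show ?thesis by (simp add: W_def I_def)
qed

text \<open>Truncation makes the supremum \<open>\<beta>\<close> of the normalised deficits finite,
  at most \<open>N\<close>. The stopping step on every interval gives
  \<open>\<beta> \<le> ln (8 * V) + (1 - \<eta>) * \<beta>\<close>, and a finite
  \<open>\<beta>\<close> may be solved for; the outcome is free of \<open>N\<close>.\<close>

lemma truncated_deficit_bound:
  assumes N: "0 \<le> N" and j: "j < 2 ^ k"
  shows "(\<integral>\<^sup>+x\<in>dyadic k j. ennreal (min N (max 0 (ln (mn k j / v x)))) \<partial>lborel)
    \<le> ennreal (ln (8 * V) / \<eta> / 2 ^ k)"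
proof -
  define \<phi> where "\<phi> k j = (\<integral>\<^sup>+x\<in>dyadic k j. ennreal (min N (max 0 (ln (mn k j / v x)))) \<partial>lborel)" for k j
  define R where "R = (\<lambda>(k, j). 2 ^ k * enn2real (\<phi> k j)) ` {(k, j). j < 2 ^ k}"
  have \<phi>_le: "\<phi> k j \<le> ennreal (N / 2 ^ k)" for k j
  proof -
    have "\<phi> k j \<le> (\<integral>\<^sup>+x. ennreal N * indicator (dyadic k j) x \<partial>lborel)"
      unfolding \<phi>_def by (intro nn_integral_mono mult_right_mono ennreal_leI) auto
    then show ?thesis using N by (simp add: nn_integral_cmult_indicator emeasure_dyadic ennreal_mult[symmetric])
  qed
  have "2 ^ k * enn2real (\<phi> k j) \<le> N" for k j
    using enn2real_mono[OF \<phi>_le[of k j]] N by (simp add: field_simps)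
  then have bdd: "bdd_above R" by (auto simp: R_def bdd_above_def)
  have ne: "R \<noteq> {}" by (auto simp: R_def intro: exI[of _ "0::nat"])
  define \<beta> where "\<beta> = Sup R"
  have R_le: "2 ^ k * enn2real (\<phi> k j) \<le> \<beta>" if "j < 2 ^ k" for k j
    unfolding \<beta>_def using that by (intro cSup_upper bdd) (auto simp: R_def)
  have "0 \<le> 2 ^ 0 * enn2real (\<phi> 0 0)" by simp
  also have "\<dots> \<le> \<beta>" by (rule R_le) simp
  finally have \<beta>: "0 \<le> \<beta>" .
  have \<phi>_\<beta>: "\<phi> k j \<le> ennreal (\<beta> / 2 ^ k)" if "j < 2 ^ k" for k j
  proof -
    have "\<phi> k j = ennreal (enn2real (\<phi> k j))"
      using \<phi>_le[of k j] by (metis ennreal_enn2real_if ennreal_neq_top top_unique)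
    also have "\<dots> \<le> ennreal (\<beta> / 2 ^ k)"
      using R_le[OF that] by (intro ennreal_leI) (simp add: field_simps)
    finally show ?thesis .
  qed
  have "\<beta> \<le> ln (8 * V) + (1 - \<eta>) * \<beta>"
    unfolding \<beta>_def
  proof (rule cSup_least[OF ne], fold \<beta>_def)
    fix r assume "r \<in> R"
    then obtain k j where r: "j < 2 ^ k" "r = 2 ^ k * enn2real (\<phi> k j)" by (auto simp: R_def)
    have nn: "0 \<le> ln (8 * V) + (1 - \<eta>) * \<beta>" using V_ge eta \<beta> by simp
    have "\<phi> k j \<le> ennreal ((ln (8 * V) + (1 - \<eta>) * \<beta>) / 2 ^ k)"
      unfolding \<phi>_def using \<phi>_\<beta> r(1) by (intro truncated_deficit_step N \<beta>) (auto simp: \<phi>_def)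
    from enn2real_mono[OF this] show "r \<le> ln (8 * V) + (1 - \<eta>) * \<beta>"
      using nn by (simp add: r field_simps)
  qed
  then have "\<beta> \<le> ln (8 * V) / \<eta>" using eta by (simp add: field_simps)
  then have "ennreal (\<beta> / 2 ^ k) \<le> ennreal (ln (8 * V) / \<eta> / 2 ^ k)"
    by (intro ennreal_leI divide_right_mono) auto
  then show ?thesis using \<phi>_\<beta>[OF j] by (simp add: \<phi>_def)
qed

text \<open>Since the truncated bound is uniform in \<open>N\<close>, monotone convergence removes
  the truncation.\<close>

lemma deficit_bound:
  assumes j: "j < 2 ^ k"
  shows "(\<integral>\<^sup>+x\<in>dyadic k j. ennreal (max 0 (ln (mn k j / v x))) \<partial>lborel) \<le> ennreal (ln (8 * V) / \<eta> / 2 ^ k)"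
proof -
  define f where "f n x = ennreal (min (real n) (max 0 (ln (mn k j / v x)))) * indicator (dyadic k j) x" for n x
  have "(SUP n. f n x) = ennreal (max 0 (ln (mn k j / v x))) * indicator (dyadic k j) x" for x
  proof (rule antisym)
    show "(SUP n. f n x) \<le> ennreal (max 0 (ln (mn k j / v x))) * indicator (dyadic k j) x"
      by (intro SUP_least) (auto simp: f_def intro!: mult_right_mono ennreal_leI)
    obtain n :: nat where "max 0 (ln (mn k j / v x)) \<le> real n" using real_arch_simple by blast
    then have "ennreal (max 0 (ln (mn k j / v x))) * indicator (dyadic k j) x = f n x"
      by (simp add: f_def min_absorb2 del: max.bounded_iff)
    also have "\<dots> \<le> (SUP n. f n x)" by (rule SUP_upper) simp
    finally show "ennreal (max 0 (ln (mn k j / v x))) * indicator (dyadic k j) x \<le> (SUP n. f n x)" .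
  qed
  then have "(\<integral>\<^sup>+x\<in>dyadic k j. ennreal (max 0 (ln (mn k j / v x))) \<partial>lborel) = (\<integral>\<^sup>+x. (SUP n. f n x) \<partial>lborel)"
    by simp
  also have "\<dots> = (SUP n. \<integral>\<^sup>+x. f n x \<partial>lborel)"
  proof (rule nn_integral_monotone_convergence_SUP)
    show "incseq f"
      by (auto simp: incseq_def le_fun_def f_def intro!: mult_right_mono ennreal_leI)
    show "f n \<in> borel_measurable lborel" for n
      unfolding f_def by measurable
  qed
  also have "\<dots> \<le> ennreal (ln (8 * V) / \<eta> / 2 ^ k)"
    unfolding f_def by (intro SUP_least truncated_deficit_bound j) simp
  finally show ?thesis .
qed

end

subsection \<open>Rotations, arcs and neighbouring dyadic intervals\<close>

text \<open>The circle as a probability space. The half-open interval gives each point one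
  representative, and the Borel sets keep products, sections and rotations measurable.\<close>

definition circ :: "real measure" where
  "circ = restrict_space lborel {0..<1}"

lemma space_circ [simp]: "space circ = {0..<1}"
  by (simp add: circ_def space_restrict_space)

lemma sets_circ: "A \<in> sets circ \<longleftrightarrow> A \<in> sets borel \<and> A \<subseteq> {0..<1}"
  by (auto simp: circ_def sets_restrict_space_iff)

lemma borel_measurable_circ: "f \<in> borel_measurable borel \<Longrightarrow> f \<in> borel_measurable circ"
  by (simp add: circ_def measurable_restrict_space1)

lemma emeasure_circ_space [simp]: "emeasure circ {0..<1} = 1"
  by (simp add: circ_def emeasure_restrict_space)

lemma finite_measure_circ: "finite_measure circ"
  by (rule finite_measureI) simp

lemma emeasure_circ: "A \<in> sets borel \<Longrightarrow> A \<subseteq> {0..<1} \<Longrightarrow> emeasure circ A = emeasure lborel A"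
  by (simp add: circ_def emeasure_restrict_space)

lemma nn_integral_circ: "(\<integral>\<^sup>+x. f x \<partial>circ) = (\<integral>\<^sup>+x\<in>{0..<1}. f x \<partial>lborel)"
  by (simp add: circ_def nn_integral_restrict_space)

lemma AE_circ: "(AE x in circ. P x) \<longleftrightarrow> (AE x in lborel. x \<in> {0..<1} \<longrightarrow> P x)"
  unfolding circ_def by (rule AE_restrict_space_iff) simp

lemma frac_add_measurable [measurable]: "(\<lambda>x::real. frac (x + t)) \<in> borel_measurable borel"
  unfolding frac_def by measurable

lemma rotation_measurable: "(\<lambda>x. frac (x + t)) \<in> circ \<rightarrow>\<^sub>M circ"
  unfolding circ_def
  by (intro measurable_restrict_space2 measurable_restrict_space1) (auto simp: frac_lt_1)

lemma emeasure_lborel_translate: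
  assumes "A \<in> sets borel"
  shows "emeasure lborel {x. x + c \<in> A} = emeasure lborel (A :: real set)"
proof -
  have "emeasure lborel A = emeasure (distr lborel borel ((+) c)) A"
    by (simp add: lborel_distr_plus)
  also have "\<dots> = emeasure lborel {x. x + c \<in> A}"
    using assms by (subst emeasure_distr) (auto simp: vimage_def add.commute)
  finally show ?thesis by simp
qed

text \<open>The preimage of \<open>A\<close> consists of the points that do not wrap around
  (\<open>?A1\<close>) and those that do (\<open>?A2\<close>). Both are translates of disjoint
  pieces of \<open>A\<close>, so translation invariance on the line suffices.\<close>

lemma distr_rotation:
  assumes t: "t \<in> {0..1}"
  shows "distr circ circ (\<lambda>x. frac (x + t)) = circ"
proof (rule measure_eqI)
  fix A assume "A \<in> sets (distr circ circ (\<lambda>x. frac (x + t)))"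
  then have A [measurable]: "A \<in> sets borel" and A01: "A \<subseteq> {0..<1}" by (auto simp: sets_circ)
  let ?A1 = "{x. x + t \<in> A \<inter> {t..<1}}" and ?A2 = "{x. x + (t - 1) \<in> A \<inter> {0..<t}}"
  have eq: "(\<lambda>x. frac (x + t)) -` A \<inter> space circ = ?A1 \<union> ?A2"
  proof (intro set_eqI iffI)
    fix x assume "x \<in> (\<lambda>x. frac (x + t)) -` A \<inter> space circ"
    then have x: "0 \<le> x" "x < 1" "frac (x + t) \<in> A" by auto
    show "x \<in> ?A1 \<union> ?A2"
    proof (cases "x + t < 1")
      case True
      then have "frac (x + t) = x + t" using x t by (simp add: frac_eq)
      then show ?thesis using x t True by auto
    next
      case False
      then have "frac (x + t) = x + t - 1" using x t by (simp add: frac_unique_iff)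
      then have "x + (t - 1) \<in> A" using x by (simp add: add_diff_eq)
      then show ?thesis using x t False by auto
    qed
  next
    fix x assume "x \<in> ?A1 \<union> ?A2"
    then show "x \<in> (\<lambda>x. frac (x + t)) -` A \<inter> space circ"
    proof
      assume "x \<in> ?A1"
      moreover from this have "frac (x + t) = x + t" using t by (simp add: frac_eq)
      ultimately show ?thesis using t by auto
    next
      assume x: "x \<in> ?A2"
      then have "frac (x + t) = x + (t - 1)" using t by (subst frac_unique_iff) auto
      then show ?thesis using x t by auto
    qed
  qed
  have [measurable]: "?A1 \<in> sets borel" "?A2 \<in> sets borel" by measurable
  have "emeasure (distr circ circ (\<lambda>x. frac (x + t))) A = emeasure lborel (?A1 \<union> ?A2)"
    unfolding eq[symmetric] using A A01
    by (subst emeasure_distr[OF rotation_measurable])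
       (auto simp: sets_circ emeasure_circ intro!: emeasure_circ)
  also have "\<dots> = emeasure lborel ?A1 + emeasure lborel ?A2"
    using A01 t by (intro plus_emeasure[symmetric]) auto
  also have "\<dots> = emeasure lborel (A \<inter> {t..<1}) + emeasure lborel (A \<inter> {0..<t})"
    by (intro arg_cong2[where f="(+)"] emeasure_lborel_translate) auto
  also have "\<dots> = emeasure lborel (A \<inter> {t..<1} \<union> A \<inter> {0..<t})"
    by (intro plus_emeasure) auto
  also have "A \<inter> {t..<1} \<union> A \<inter> {0..<t} = A" using A01 t by auto
  finally show "emeasure (distr circ circ (\<lambda>x. frac (x + t))) A = emeasure circ A"
    using A A01 by (simp add: emeasure_circ)
qed simp

lemma nn_integral_rotation:
  assumes "t \<in> {0..1}" "f \<in> borel_measurable borel"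
  shows "(\<integral>\<^sup>+x. f (frac (x + t)) \<partial>circ) = (\<integral>\<^sup>+x. f x \<partial>circ)"
proof -
  have "(\<integral>\<^sup>+x. f x \<partial>circ) = (\<integral>\<^sup>+x. f x \<partial>distr circ circ (\<lambda>x. frac (x + t)))"
    by (simp only: distr_rotation[OF assms(1)])
  also have "\<dots> = (\<integral>\<^sup>+x. f (frac (x + t)) \<partial>circ)"
    by (rule nn_integral_distr[OF rotation_measurable])
       (subst measurable_cong_sets[OF sets_distr refl], rule borel_measurable_circ, rule assms(2))
  finally show ?thesis by simp
qed

lemma integral_rotation:
  fixes f :: "real \<Rightarrow> real"
  assumes "t \<in> {0..1}" "f \<in> borel_measurable borel"
  shows "(\<integral>x. f (frac (x + t)) \<partial>circ) = (\<integral>x. f x \<partial>circ)"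
proof -
  have "(\<integral>x. f x \<partial>circ) = (\<integral>x. f x \<partial>distr circ circ (\<lambda>x. frac (x + t)))"
    by (simp only: distr_rotation[OF assms(1)])
  also have "\<dots> = (\<integral>x. f (frac (x + t)) \<partial>circ)"
    using assms(2) by (intro integral_distr rotation_measurable borel_measurable_circ)
  finally show ?thesis by simp
qed

lemma AE_rotation:
  assumes "t \<in> {0..1}" "AE x in circ. P x"
  shows "AE x in circ. P (frac (x + t))"
proof -
  have "AE x in distr circ circ (\<lambda>x. frac (x + t)). P x"
    using assms by (simp only: distr_rotation)
  then show ?thesis by (rule AE_distrD[OF rotation_measurable])
qed

lemma frac_diff_of_int: "frac (x - of_int k :: real) = frac x"
  by (simp add: frac_def)

lemma frac_diff_frac: "frac (frac (x + t) - frac (a + t)) = frac (x - a :: real)"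
proof -
  have "frac (x + t) - frac (a + t) = x - a - of_int (\<lfloor>x + t\<rfloor> - \<lfloor>a + t\<rfloor>)"
    by (simp add: frac_def)
  then show ?thesis by (simp only: frac_diff_of_int)
qed

lemma arc_rotate: "x \<in> {0..<1} \<Longrightarrow> frac (x + t) \<in> arc (frac (a + t)) l \<longleftrightarrow> x \<in> arc a l"
  by (simp add: arc_def frac_diff_frac frac_lt_1)

lemma arc_sets [measurable, simp]: "arc a l \<in> sets borel"
proof -
  have "{x\<in>space borel. x \<in> {0..<1} \<and> frac (x + (- a)) < l} \<in> sets borel" by measurable
  then show ?thesis by (simp add: arc_def)
qed

lemma arc_subset: "arc a l \<subseteq> {0..<1}"
  by (auto simp: arc_def)

text \<open>Rotation invariance reduces every arc, wrapped or not, to \<open>{0..<l}\<close>. The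
  angle is \<open>1 - a\<close> instead of \<open>- a\<close> so that it lies in
  \<open>{0..1}\<close>.\<close>

lemma emeasure_arc:
  assumes "a \<in> {0..<1}" "l \<in> {0<..1}"
  shows "emeasure lborel (arc a l) = ennreal l"
proof -
  have "emeasure lborel (arc a l) = (\<integral>\<^sup>+x. indicator (arc a l) x \<partial>circ)"
    using emeasure_circ[OF arc_sets arc_subset, of a l] by (simp add: sets_circ arc_subset)
  also have "\<dots> = (\<integral>\<^sup>+x. indicator {0..<l} (frac (x + (1 - a))) \<partial>circ)"
  proof (rule nn_integral_cong)
    fix x :: real assume "x \<in> space circ"
    have "frac (x + (1 - a)) = frac (x - a + of_int 1)" by (simp add: algebra_simps)
    also have "\<dots> = frac (x - a)" by (simp only: frac_def floor_add_int[symmetric] of_int_add add_diff_cancel_right)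
    finally have "frac (x + (1 - a)) = frac (x - a)" .
    then show "indicator (arc a l) x = (indicator {0..<l} (frac (x + (1 - a))) :: ennreal)"
      using \<open>x \<in> space circ\<close> by (simp add: arc_def indicator_def)
  qed
  also have "\<dots> = (\<integral>\<^sup>+x. indicator {0..<l} x \<partial>circ)"
    using assms by (intro nn_integral_rotation) auto
  also have "\<dots> = ennreal l"
    using assms emeasure_circ[of "{0..<l}"] by (subst nn_integral_indicator) (auto simp: sets_circ)
  finally show ?thesis .
qed

lemma measure_arc: "a \<in> {0..<1} \<Longrightarrow> l \<in> {0<..1} \<Longrightarrow> measure lborel (arc a l) = l"
  by (simp add: measure_def emeasure_arc)

text \<open>An arc starting in a dyadic interval and no longer than it cannot run past the right
  neighbour; \<open>mod\<close> makes the first interval the neighbour of the last.\<close>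

lemma arc_subset_dyadic:
  assumes a: "a \<in> dyadic n j" "a \<in> {0..<1}" and l: "l \<le> 1 / 2 ^ n"
  shows "arc a l \<subseteq> dyadic n j \<union> dyadic n ((j + 1) mod 2 ^ n)"
proof
  fix x assume "x \<in> arc a l"
  then have x: "0 \<le> x" "x < 1" "frac (x - a) < 1 / 2 ^ n" using l by (auto simp: arc_def)
  have aj: "real j \<le> a * 2 ^ n" "a * 2 ^ n < real j + 1"
    using a by (auto simp: dyadic_def field_simps)
  have frac_n: "frac (x - a) * 2 ^ n < 1" using x(3) by (simp add: field_simps)
  have xn: "x * 2 ^ n < 2 ^ n" "a * 2 ^ n < 2 ^ n" using x a by auto
  show "x \<in> dyadic n j \<union> dyadic n ((j + 1) mod 2 ^ n)"
  proof (cases "a \<le> x")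
    case True
    then have "frac (x - a) = x - a" using x a by (simp add: frac_eq)
    then have "(x - a) * 2 ^ n < 1" using frac_n by (simp only:)
    then have "x * 2 ^ n < a * 2 ^ n + 1" by (simp add: algebra_simps)
    moreover have "a * 2 ^ n \<le> x * 2 ^ n" using True by simp
    ultimately have "real j \<le> x * 2 ^ n" "x * 2 ^ n < real j + 2" using aj by linarith+
    then have "\<lfloor>x * 2 ^ n\<rfloor> = int j \<or> \<lfloor>x * 2 ^ n\<rfloor> = int (j + 1)"
      by (auto simp: floor_eq_iff)
    then show ?thesis
    proof
      assume *: "\<lfloor>x * 2 ^ n\<rfloor> = int (j + 1)"
      then have "real (j + 1) \<le> x * 2 ^ n" by linarith
      from order_le_less_trans[OF this xn(1)] have "real (j + 1) < real (2 ^ n)" by simp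
      then have "j + 1 < 2 ^ n" by linarith
      then show ?thesis using * by (simp add: mem_dyadic_iff)
    qed (simp add: mem_dyadic_iff)
  next
    \<comment> \<open>Here the arc has passed 0 before reaching \<open>x\<close>. This forces
      \<open>j\<close> to be the last interval and puts \<open>x\<close> into the first.\<close>
    case False
    then have "frac (x - a) = x - a + 1" using x a by (simp add: frac_unique_iff)
    then have "(x - a + 1) * 2 ^ n < 1" using frac_n by (simp only:)
    then have *: "x * 2 ^ n + 2 ^ n < a * 2 ^ n + 1" by (simp add: algebra_simps)
    then have "x * 2 ^ n < 1" using xn by linarith
    then have x0: "\<lfloor>x * 2 ^ n\<rfloor> = 0" using x by (simp add: floor_eq_iff)
    have "0 \<le> x * 2 ^ n" using x by simp
    then have "2 ^ n < real j + 2" "real j < 2 ^ n" using * aj xn by linarith+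
    then have "real (2 ^ n) < real (j + 2)" "real j < real (2 ^ n)" by simp_all
    then have "2 ^ n < j + 2" "j < 2 ^ n" by linarith+
    then have "j + 1 = 2 ^ n" by simp
    then show ?thesis using x0 by (simp add: mem_dyadic_iff)
  qed
qed

text \<open>\<open>adj n j\<close> is the number of generations one has to climb from \<open>dyadic n j\<close> and its right
  neighbour on the circle to reach a common ancestor.\<close>

fun adj :: "nat \<Rightarrow> nat \<Rightarrow> nat" where
  "adj 0 j = 0"
| "adj (Suc n) j = (if even j then 1 else 1 + adj n (j div 2))"

lemma sum_even_odd: "(\<Sum>j<2 * m. f j) = (\<Sum>i<m. f (2 * i) + f (2 * i + 1) :: nat)" for m :: nat
  by (induction m) auto

text \<open>The siblings \<open>2 * i\<close> and \<open>2 * i + 1\<close> contribute 1 and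
  \<open>1 + adj n i\<close>. So the sum grows by \<open>2 * 2 ^ n\<close> from generation
  \<open>n\<close> to the next, and the mean of \<open>adj\<close> stays below 2.\<close>

lemma sum_adj: "(\<Sum>j<2 ^ n. adj n j) \<le> 2 * 2 ^ n"
proof (induction n)
  case (Suc n)
  have "(\<Sum>j<2 ^ Suc n. adj (Suc n) j) = (\<Sum>i<2 ^ n. 2 + adj n i)"
    unfolding power_Suc sum_even_odd by (intro sum.cong) auto
  also have "\<dots> = 2 * 2 ^ n + (\<Sum>i<2 ^ n. adj n i)" by (simp add: sum.distrib del: add_2_eq_Suc)
  also have "\<dots> \<le> 2 * 2 ^ Suc n" using Suc.IH by simp
  finally show ?case .
qed simp

section \<open>Averages over neighbouring dyadic intervals and over arcs\<close>

context dyadic_weight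
begin

lemma ln_mn_parent:
  assumes "j < 2 ^ Suc k"
  shows "\<bar>ln (mn (Suc k) j) - ln (mn k (j div 2))\<bar> \<le> ln V"
proof -
  have "j div 2 < 2 ^ k" using assms by auto
  then have pos: "0 < mn (Suc k) j" "0 < mn k (j div 2)" using mn_pos assms by auto
  have "mn k (j div 2) \<le> V * mn (Suc k) j" using mn_parent(1)[OF assms] pos by simp
  then have "ln (mn k (j div 2)) \<le> ln (V * mn (Suc k) j)" using pos V_ge by simp
  moreover have "2 * mn k (j div 2) \<le> V * mn k (j div 2)" using pos V_ge by simp
  then have "mn (Suc k) j \<le> V * mn k (j div 2)" using mn_parent(2)[OF assms] by linarith
  then have "ln (mn (Suc k) j) \<le> ln (V * mn k (j div 2))" using pos V_ge by simp
  ultimately show ?thesis using pos V_ge by (simp add: ln_mult abs_le_iff)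
qed

text \<open>Passing from both neighbours to their parents costs \<open>ln V\<close> each. For even
  \<open>j\<close> the parents coincide, for odd \<open>j\<close> they are neighbours again: this is
  the recursion of \<open>adj\<close>.\<close>

lemma ln_mn_adjacent:
  assumes "j < 2 ^ n"
  shows "\<bar>ln (mn n ((j + 1) mod 2 ^ n)) - ln (mn n j)\<bar> \<le> 2 * ln V * real (adj n j)"
  using assms
proof (induction n arbitrary: j)
  case (Suc n)
  let ?j' = "(j + 1) mod 2 ^ Suc n"
  have j': "?j' < 2 ^ Suc n" by simp
  have jd: "j div 2 < 2 ^ n" using Suc.prems by auto
  have *: "\<bar>ln (mn n (?j' div 2)) - ln (mn n (j div 2))\<bar> \<le> 2 * ln V * (real (adj (Suc n) j) - 1)"
  proof (cases "even j")
    case True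
    then have "j + 1 < 2 ^ Suc n"
      using Suc.prems by (metis Suc_eq_plus1 Suc_lessI dvd_triv_left even_Suc power_Suc)
    then have "?j' div 2 = j div 2" using True by simp
    then show ?thesis using True by simp
  next
    case False
    have "?j' div 2 = (j + 1) div 2 mod 2 ^ n"
      by (simp add: mod_mult2_eq)
    also have "(j + 1) div 2 = j div 2 + 1" using False by (auto elim!: oddE)
    finally show ?thesis using Suc.IH[OF jd] False by simp
  qed
  then have "\<bar>ln (mn n (?j' div 2)) - ln (mn n (j div 2))\<bar> \<le> 2 * ln V * real (adj (Suc n) j) - 2 * ln V"
    by (simp only: right_diff_distrib mult_1_right)
  then show ?case
    using ln_mn_parent[OF Suc.prems] ln_mn_parent[OF j'] by linarith
qed simp

text \<open>A converse to Jensen's inequality: the deficit bounds on the two covering intervals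
  limit the integral of \<open>b - ln v\<close> over the arc. On the second interval the reference
  average is the neighbour's, which costs \<open>\<delta>\<close>. Since
  \<open>1 / 2 ^ n < 2 * l\<close>, dividing by \<open>l\<close> doubles
  \<open>2 * B + \<delta>\<close>; this explains both factors 4.\<close>

lemma ln_mn_le_arc_average:
  assumes a: "a \<in> dyadic n j" "a \<in> {0..<1}" and l: "l \<in> {0<..1}" "l \<le> 1 / 2 ^ n" "1 < 2 * 2 ^ n * l"
    and ln_int: "set_integrable lborel {0..<1} (\<lambda>x. ln (v x))"
  shows "ln (mn n j) \<le> (LINT x:arc a l|lborel. ln (v x)) / l + 4 * (ln (8 * V) / \<eta>) + 4 * ln V * real (adj n j)"
proof -
  define j' where "j' = (j + 1) mod 2 ^ n"
  define b where "b = ln (mn n j)"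
  define B where "B = ln (8 * V) / \<eta>"
  define \<delta> where "\<delta> = 2 * ln V * real (adj n j)"
  let ?Q = "arc a l"
  have j: "j < 2 ^ n"
  proof -
    obtain i where "i < 2 ^ n" "a \<in> dyadic n i" using ex_dyadic_mem[OF a(2)] by blast
    then show ?thesis using a(1) dyadic_mem_unique by blast
  qed
  have j': "j' < 2 ^ n" by (simp add: j'_def)
  have pos: "0 < mn n j" "0 < mn n j'" using mn_pos j j' by auto
  have nn: "0 \<le> B" "0 \<le> \<delta>" using V_ge eta by (auto simp: B_def \<delta>_def)
  have adj: "b \<le> ln (mn n j') + \<delta>"
    using ln_mn_adjacent[OF j] by (simp add: b_def \<delta>_def j'_def abs_le_iff)
  have int: "integrable lborel (\<lambda>x. indicat_real ?Q x * (b - ln (v x)))"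
  proof -
    have "set_integrable lborel ?Q (\<lambda>x. ln (v x))"
      using set_integrable_subset[OF ln_int _ arc_subset] by simp
    moreover have "set_integrable lborel ?Q (\<lambda>x. b)"
      using emeasure_arc[OF a(2) l(1)] by (simp add: set_integrable_def integrable_indicator_iff)
    ultimately have "set_integrable lborel ?Q (\<lambda>x. b - ln (v x))" by (intro set_integral_diff)
    then show ?thesis by (simp add: set_integrable_def)
  qed
  \<comment> \<open>The positive part is taken so that the domain may be enlarged from the arc to
    the two dyadic intervals.\<close>
  have "ennreal (\<integral>x. indicat_real ?Q x * (b - ln (v x)) \<partial>lborel)
      \<le> ennreal (\<integral>x. max 0 (indicat_real ?Q x * (b - ln (v x))) \<partial>lborel)"
    using int by (intro ennreal_leI integral_mono) auto
  also have "\<dots> = (\<integral>\<^sup>+x. ennreal (max 0 (indicat_real ?Q x * (b - ln (v x)))) \<partial>lborel)"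
    using int by (intro nn_integral_eq_integral[symmetric]) auto
  also have "\<dots> \<le> (\<integral>\<^sup>+x. ennreal (max 0 (ln (mn n j / v x))) * indicator (dyadic n j) x +
       (ennreal (max 0 (ln (mn n j' / v x))) * indicator (dyadic n j') x + ennreal \<delta> * indicator (dyadic n j') x) \<partial>lborel)"
  proof (rule nn_integral_mono)
    fix x
    have eq: "ln (mn n j / v x) = b - ln (v x)" "ln (mn n j' / v x) = ln (mn n j') - ln (v x)"
      using pos v_pos[of x] by (simp_all add: ln_div b_def)
    consider "x \<notin> ?Q" | "x \<in> ?Q" "x \<in> dyadic n j" | "x \<in> ?Q" "x \<in> dyadic n j'"
      using arc_subset_dyadic[OF a l(2)] by (auto simp: j'_def)
    then show "ennreal (max 0 (indicat_real ?Q x * (b - ln (v x))))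
      \<le> ennreal (max 0 (ln (mn n j / v x))) * indicator (dyadic n j) x +
       (ennreal (max 0 (ln (mn n j' / v x))) * indicator (dyadic n j') x + ennreal \<delta> * indicator (dyadic n j') x)"
    proof cases
      case 2
      then show ?thesis by (simp add: eq add_increasing2)
    next
      case 3
      have "max 0 (b - ln (v x)) \<le> max 0 (ln (mn n j') - ln (v x)) + \<delta>"
        using adj nn by (auto simp: max_def)
      then have "ennreal (max 0 (b - ln (v x))) \<le> ennreal (max 0 (ln (mn n j') - ln (v x))) + ennreal \<delta>"
        using nn by (subst ennreal_plus[symmetric]) (auto intro!: ennreal_leI simp del: ennreal_plus)
      then show ?thesis using 3 by (simp add: eq add_increasing)
    qed simp
  qed
  also have "\<dots> = (\<integral>\<^sup>+x\<in>dyadic n j. ennreal (max 0 (ln (mn n j / v x))) \<partial>lborel) +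
       ((\<integral>\<^sup>+x\<in>dyadic n j'. ennreal (max 0 (ln (mn n j' / v x))) \<partial>lborel) + ennreal \<delta> * ennreal (1 / 2 ^ n))"
    by (subst nn_integral_add; (subst nn_integral_add)?)
       (auto simp: nn_integral_cmult_indicator emeasure_dyadic)
  also have "\<dots> \<le> ennreal (B / 2 ^ n) + (ennreal (B / 2 ^ n) + ennreal \<delta> * ennreal (1 / 2 ^ n))"
    unfolding B_def by (intro add_mono deficit_bound j j' order_refl)
  also have "\<dots> = ennreal ((2 * B + \<delta>) / 2 ^ n)"
    using nn by (simp add: ennreal_mult[symmetric] ennreal_plus[symmetric] add_divide_distrib del: ennreal_plus)
  finally have "(\<integral>x. indicat_real ?Q x * (b - ln (v x)) \<partial>lborel) \<le> (2 * B + \<delta>) / 2 ^ n"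
    using nn by (subst (asm) ennreal_le_iff) auto
  also have "\<dots> \<le> (2 * B + \<delta>) * (2 * l)"
  proof -
    have "1 / 2 ^ n \<le> 2 * l" using l(3) by (simp add: field_simps)
    from mult_left_mono[OF this, of "2 * B + \<delta>"] show ?thesis using nn by simp
  qed
  also have "(\<integral>x. indicat_real ?Q x * (b - ln (v x)) \<partial>lborel) = b * l - (LINT x:?Q|lborel. ln (v x))"
  proof -
    have "set_integrable lborel ?Q (\<lambda>x. ln (v x))"
      using set_integrable_subset[OF ln_int _ arc_subset] by simp
    then show ?thesis
      unfolding set_lebesgue_integral_def set_integrable_def
      using measure_arc[OF a(2) l(1)] emeasure_arc[OF a(2) l(1)]
      by (simp add: right_diff_distrib integrable_indicator_iff)
  qed
  finally have "b \<le> (LINT x:?Q|lborel. ln (v x)) / l + 2 * (2 * B + \<delta>)"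
    using l by (simp add: field_simps)
  then show ?thesis by (simp add: b_def B_def \<delta>_def algebra_simps)
qed

end

subsection \<open>Means over arcs\<close>

text \<open>A bound \<open>K\<close> on the normalised L^p norm over \<open>E\<close>, or on the
  essential supremum. With nonnegative integrals and the measure multiplied out, it makes sense
  before integrability is known.\<close>

definition Lp_mean_le :: "ereal \<Rightarrow> (real \<Rightarrow> real) \<Rightarrow> real set \<Rightarrow> real \<Rightarrow> bool" where
  "Lp_mean_le p v E K \<longleftrightarrow>
     (if p = \<infinity> then AE x in lborel. x \<in> E \<longrightarrow> v x \<le> K
      else (\<integral>\<^sup>+x\<in>E. ennreal (v x powr real_of_ereal p) \<partial>lborel)
             \<le> ennreal (K powr real_of_ereal p) * emeasure lborel E)"

lemma ereal_gt_one_cases: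
  assumes "1 < (p::ereal)"
  obtains (inf) "p = \<infinity>" | (real) r where "p = ereal r" "1 < r"
  using assms by (cases p) auto

lemma Lp_mean_le_mono:
  assumes "1 < p" "Lp_mean_le p v E K" "0 \<le> K" "K \<le> K'"
  shows "Lp_mean_le p v E K'"
  using assms(1)
proof (cases rule: ereal_gt_one_cases)
  case inf
  then show ?thesis using assms by (auto simp: Lp_mean_le_def elim!: eventually_mono)
next
  case (real r)
  have "ennreal (K powr r) * emeasure lborel E \<le> ennreal (K' powr r) * emeasure lborel E"
    using assms real by (intro mult_right_mono ennreal_leI powr_mono2) auto
  then show ?thesis using assms(2) real by (auto simp: Lp_mean_le_def)
qed

text \<open>Two pieces, each at most twice as large as \<open>E\<close>, give the factor 4 in front
  of \<open>K powr r\<close>; it moves inside the power because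
  \<open>4 \<le> 4 powr r\<close>.\<close>

lemma Lp_mean_le_cover:
  assumes p: "1 < p" and K: "0 \<le> K" and [measurable]: "v \<in> borel_measurable borel"
    and [measurable]: "E \<in> sets borel" "J \<in> sets borel" "J' \<in> sets borel"
    and sub: "E \<subseteq> J \<union> J'"
    and meas: "emeasure lborel J \<le> 2 * emeasure lborel E" "emeasure lborel J' \<le> 2 * emeasure lborel E"
    and J: "Lp_mean_le p v J K" and J': "Lp_mean_le p v J' K"
  shows "Lp_mean_le p v E (4 * K)"
  using p
proof (cases rule: ereal_gt_one_cases)
  case inf
  have "AE x in lborel. x \<in> J \<longrightarrow> v x \<le> K" "AE x in lborel. x \<in> J' \<longrightarrow> v x \<le> K"
    using J J' inf by (simp_all add: Lp_mean_le_def)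
  then have "AE x in lborel. x \<in> E \<longrightarrow> v x \<le> 4 * K"
    by eventually_elim (use sub K in fastforce)
  then show ?thesis by (simp add: inf Lp_mean_le_def)
next
  case (real r)
  have "(\<integral>\<^sup>+x\<in>E. ennreal (v x powr r) \<partial>lborel)
     \<le> (\<integral>\<^sup>+x. ennreal (v x powr r) * indicator J x + ennreal (v x powr r) * indicator J' x \<partial>lborel)"
    using sub by (intro nn_integral_mono) (auto simp: indicator_def)
  also have "\<dots> = (\<integral>\<^sup>+x\<in>J. ennreal (v x powr r) \<partial>lborel) + (\<integral>\<^sup>+x\<in>J'. ennreal (v x powr r) \<partial>lborel)"
    by (rule nn_integral_add) auto
  also have "\<dots> \<le> ennreal (K powr r) * emeasure lborel J + ennreal (K powr r) * emeasure lborel J'"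
    using J J' real by (intro add_mono) (auto simp: Lp_mean_le_def)
  also have "\<dots> \<le> ennreal (K powr r) * (2 * emeasure lborel E) + ennreal (K powr r) * (2 * emeasure lborel E)"
    using meas by (intro add_mono mult_left_mono) auto
  also have "\<dots> = (ennreal (K powr r) * 4) * emeasure lborel E"
    by (simp only: mult_2[symmetric], simp add: mult_ac)
  also have "ennreal (K powr r) * 4 = ennreal (4 * K powr r)"
    by (simp add: ennreal_mult mult.commute)
  also have "\<dots> \<le> ennreal ((4 * K) powr r)"
  proof (rule ennreal_leI)
    have "(4::real) powr 1 \<le> 4 powr r" using real by (intro powr_mono) auto
    then show "4 * K powr r \<le> (4 * K) powr r"
      using K by (simp add: powr_mult mult_right_mono)
  qed
  finally show ?thesis by (simp add: real Lp_mean_le_def mult_right_mono)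
qed

text \<open>\<open>RHd_le\<close> for a positive Borel representative; \<open>2 ^ k\<close> times
  the integral is the average over the interval.\<close>

definition dyadic_RH :: "ereal \<Rightarrow> real \<Rightarrow> (real \<Rightarrow> real) \<Rightarrow> bool" where
  "dyadic_RH p V v \<longleftrightarrow> v \<in> borel_measurable borel \<and> (\<forall>x. 0 < v x) \<and> set_integrable lborel {0..<1} v \<and>
    (\<forall>k j. j < 2 ^ Suc k \<longrightarrow>
      (LINT x:dyadic k (j div 2)|lborel. v x) \<le> V * (LINT x:dyadic (Suc k) j|lborel. v x)) \<and>
    (\<forall>k j. j < 2 ^ k \<longrightarrow> Lp_mean_le p v (dyadic k j) (V * (2 ^ k * (LINT x:dyadic k j|lborel. v x))))"

text \<open>Splitting at height \<open>\<sigma>\<close> times the average: below it the integral over \<open>E\<close> is controlled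
  by \<open>|E|\<close>, above it by the \<open>L\<^sup>p\<close> mean.\<close>

lemma nn_integral_le_of_Lp_mean:
  assumes p: "1 < p" and V: "2 \<le> V"
  obtains \<sigma> :: real where "1 \<le> \<sigma>"
    and "\<And>v J E m. \<lbrakk>v \<in> borel_measurable borel; \<And>x. 0 < v x; 0 < m; J \<in> sets borel; E \<in> sets borel; E \<subseteq> J;
      Lp_mean_le p v J (V * m)\<rbrakk> \<Longrightarrow>
      (\<integral>\<^sup>+x\<in>E. ennreal (v x) \<partial>lborel) \<le> ennreal (\<sigma> * m) * emeasure lborel E + ennreal (m / 4) * emeasure lborel J"
  using p
proof (cases rule: ereal_gt_one_cases)
  case inf
  show ?thesis
  proof (rule that[of V])
    fix v :: "real \<Rightarrow> real" and J E :: "real set" and m :: real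
    assume [measurable]: "v \<in> borel_measurable borel" "E \<in> sets borel"
      and "E \<subseteq> J" and "Lp_mean_le p v J (V * m)"
    then have "AE x in lborel. x \<in> J \<longrightarrow> v x \<le> V * m" by (simp add: inf Lp_mean_le_def)
    then have "(\<integral>\<^sup>+x\<in>E. ennreal (v x) \<partial>lborel) \<le> (\<integral>\<^sup>+x. ennreal (V * m) * indicator E x \<partial>lborel)"
      using \<open>E \<subseteq> J\<close>
      by (intro nn_integral_mono_AE, elim eventually_mono) (auto simp: indicator_def intro!: ennreal_leI)
    then show "(\<integral>\<^sup>+x\<in>E. ennreal (v x) \<partial>lborel) \<le> ennreal (V * m) * emeasure lborel E + ennreal (m / 4) * emeasure lborel J"
      by (simp add: nn_integral_cmult_indicator add_increasing2)
  qed (use V in simp)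
next
  case (real r)
  \<comment> \<open>Chosen so that \<open>\<sigma> powr (1 - r) * V powr r\<close> is a quarter,
    which bounds the part above the height by \<open>m / 4\<close> times the measure of
    \<open>J\<close>.\<close>
  define \<sigma> where "\<sigma> = (4 * V powr r) powr (1 / (r - 1))"
  have Vr: "1 \<le> V powr r" using V real by (intro ge_one_powr_ge_zero) auto
  have "1 \<le> \<sigma>" unfolding \<sigma>_def using Vr real by (intro ge_one_powr_ge_zero) auto
  have \<sigma>: "\<sigma> powr (1 - r) = 1 / (4 * V powr r)"
  proof -
    have "1 / (r - 1) * (1 - r) = - 1" using real by (simp add: field_simps)
    then show ?thesis using Vr by (simp add: \<sigma>_def powr_powr powr_minus_divide)
  qed
  show ?thesis
  proof (rule that[OF \<open>1 \<le> \<sigma>\<close>])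
    fix v :: "real \<Rightarrow> real" and J E :: "real set" and m :: real
    assume [measurable]: "v \<in> borel_measurable borel" "J \<in> sets borel" "E \<in> sets borel"
      and vpos: "\<And>x. 0 < v x" and m: "0 < m" and "E \<subseteq> J" and J: "Lp_mean_le p v J (V * m)"
    define s where "s = \<sigma> * m"
    have s: "0 < s" using \<open>1 \<le> \<sigma>\<close> m by (simp add: s_def)
    \<comment> \<open>Above the height \<open>s\<close>, \<open>v x powr (1 - r)\<close> is at most
      \<open>s powr (1 - r)\<close> because \<open>1 - r\<close> is negative.\<close>
    have pt: "v x \<le> s + s powr (1 - r) * v x powr r" for x
    proof (cases "v x \<le> s")
      case False
      have "v x = v x powr (1 - r) * v x powr r"
        using vpos[of x] by (simp flip: powr_add)
      also have "\<dots> \<le> s powr (1 - r) * v x powr r"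
        using False s real by (intro mult_right_mono powr_mono2') auto
      finally show ?thesis using s by simp
    qed (simp add: add_increasing2)
    have "(\<integral>\<^sup>+x\<in>E. ennreal (v x) \<partial>lborel)
       \<le> (\<integral>\<^sup>+x. ennreal s * indicator E x + ennreal (s powr (1 - r)) * (ennreal (v x powr r) * indicator J x) \<partial>lborel)"
    proof (rule nn_integral_mono)
      fix x
      have "ennreal (v x) \<le> ennreal s + ennreal (s powr (1 - r)) * ennreal (v x powr r)"
        using pt[of x] s by (simp flip: ennreal_mult ennreal_plus add: ennreal_leI)
      then show "ennreal (v x) * indicator E x \<le> ennreal s * indicator E x +
          ennreal (s powr (1 - r)) * (ennreal (v x powr r) * indicator J x)"
        using \<open>E \<subseteq> J\<close> by (auto simp: indicator_def)
    qed
    also have "\<dots> = ennreal s * emeasure lborel E +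
        ennreal (s powr (1 - r)) * (\<integral>\<^sup>+x\<in>J. ennreal (v x powr r) \<partial>lborel)"
      by (subst nn_integral_add) (auto simp: nn_integral_cmult nn_integral_cmult_indicator)
    also have "\<dots> \<le> ennreal s * emeasure lborel E +
        ennreal (s powr (1 - r)) * (ennreal ((V * m) powr r) * emeasure lborel J)"
      using J real by (intro add_left_mono mult_left_mono) (auto simp: Lp_mean_le_def)
    also have "ennreal (s powr (1 - r)) * (ennreal ((V * m) powr r) * emeasure lborel J)
        = ennreal (s powr (1 - r) * (V * m) powr r) * emeasure lborel J"
      by (simp add: ennreal_mult mult.assoc)
    also have "s powr (1 - r) * (V * m) powr r = m / 4"
    proof -
      have "s powr (1 - r) * (V * m) powr r = \<sigma> powr (1 - r) * V powr r * (m powr (1 - r) * m powr r)"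
        using m V \<open>1 \<le> \<sigma>\<close> by (simp add: s_def powr_mult)
      also have "m powr (1 - r) * m powr r = m" using m by (simp flip: powr_add)
      finally show ?thesis using V by (simp add: \<sigma>)
    qed
    finally show "(\<integral>\<^sup>+x\<in>E. ennreal (v x) \<partial>lborel)
      \<le> ennreal (\<sigma> * m) * emeasure lborel E + ennreal (m / 4) * emeasure lborel J"
      by (simp add: s_def)
  qed
qed

text \<open>With \<open>\<eta> = 1 / (4 * \<sigma>)\<close> the low and the high part contribute at
  most a quarter of the mass each, together the half required by \<open>abs_cont\<close>. Obtaining
  \<open>\<eta>\<close> before \<open>v\<close> records that it depends on \<open>p\<close> and
  \<open>V\<close> only.\<close>

lemma dyadic_RH_imp_dyadic_weight:
  assumes p: "1 < p" and V: "2 \<le> V"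
  obtains \<eta> where "0 < \<eta>" and "\<And>v. dyadic_RH p V v \<Longrightarrow> dyadic_weight v V \<eta>"
proof -
  from nn_integral_le_of_Lp_mean[OF p V] obtain \<sigma> where \<sigma>: "1 \<le> \<sigma>"
    and main: "\<And>v J E m. \<lbrakk>v \<in> borel_measurable borel; \<And>x. 0 < v x; 0 < m; J \<in> sets borel; E \<in> sets borel; E \<subseteq> J;
      Lp_mean_le p v J (V * m)\<rbrakk> \<Longrightarrow>
      (\<integral>\<^sup>+x\<in>E. ennreal (v x) \<partial>lborel) \<le> ennreal (\<sigma> * m) * emeasure lborel E + ennreal (m / 4) * emeasure lborel J"
    by blast
  define \<eta> where "\<eta> = 1 / (4 * \<sigma>)"
  show ?thesis
  proof (rule that[of \<eta>])
    fix v assume v: "dyadic_RH p V v"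
    have vpos: "\<And>x. 0 < v x" and [measurable]: "v \<in> borel_measurable borel"
      and int: "set_integrable lborel {0..<1} v" using v by (auto simp: dyadic_RH_def)
    show "dyadic_weight v V \<eta>"
    proof
      fix k j :: nat and E :: "real set"
      assume j: "j < 2 ^ k" and [measurable]: "E \<in> sets borel" and E: "E \<subseteq> dyadic k j"
        and mE: "measure lborel E \<le> \<eta> / 2 ^ k"
      define m where "m = 2 ^ k * (LINT x:dyadic k j|lborel. v x)"
      have E01: "E \<subseteq> {0..<1}" using E dyadic_subset_unit[OF j] by blast
      have "set_integrable lborel E v" using set_integrable_subset[OF int _ E01] by simp
      then have eq: "(\<integral>\<^sup>+x\<in>E. ennreal (v x) \<partial>lborel) = ennreal (LINT x:E|lborel. v x)"
        unfolding set_lebesgue_integral_def set_integrable_def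
        using less_imp_le[OF vpos]
        by (subst nn_integral_eq_integral[symmetric]) (auto intro!: nn_integral_cong simp: indicator_def)
      have fin: "emeasure lborel E \<noteq> \<infinity>"
        using emeasure_mono[OF E, of lborel] by (auto simp: emeasure_dyadic top_unique)
      have "0 \<le> m" using less_imp_le[OF vpos] by (auto simp: m_def set_lebesgue_integral_def)
      show "(LINT x:E|lborel. v x) \<le> (LINT x:dyadic k j|lborel. v x) / 2"
      \<comment> \<open>Positivity of the mean is proved inside the locale that is being established
        here, so mean zero is settled by monotonicity.\<close>
      proof (cases "m = 0")
        case True
        then have "(LINT x:dyadic k j|lborel. v x) = 0" by (simp add: m_def)
        moreover have "(LINT x:E|lborel. v x) \<le> (LINT x:dyadic k j|lborel. v x)"
          unfolding set_lebesgue_integral_def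
          using \<open>set_integrable lborel E v\<close> set_integrable_subset[OF int _ dyadic_subset_unit[OF j]] E less_imp_le[OF vpos]
          by (intro integral_mono) (auto simp: set_integrable_def indicator_def)
        ultimately show ?thesis by simp
      next
        case False
        then have "0 < m" using \<open>0 \<le> m\<close> by simp
        have "ennreal (LINT x:E|lborel. v x)
            \<le> ennreal (\<sigma> * m) * emeasure lborel E + ennreal (m / 4) * emeasure lborel (dyadic k j)"
          unfolding eq[symmetric] using v j E \<open>0 < m\<close>
          by (intro main) (auto simp: dyadic_RH_def m_def)
        also have "\<dots> = ennreal (\<sigma> * m * measure lborel E + m / 4 * (1 / 2 ^ k))"
          using fin \<open>0 < m\<close> \<sigma>
          by (simp add: emeasure_eq_ennreal_measure emeasure_dyadic ennreal_mult[symmetric] ennreal_plus[symmetric]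
              del: ennreal_plus)
        finally have "(LINT x:E|lborel. v x) \<le> \<sigma> * m * measure lborel E + m / 4 * (1 / 2 ^ k)"
          using \<open>0 < m\<close> \<sigma> by (subst (asm) ennreal_le_iff) auto
        also have "\<sigma> * m * measure lborel E \<le> \<sigma> * m * (\<eta> / 2 ^ k)"
          using mE \<open>0 < m\<close> \<sigma> by (intro mult_left_mono) auto
        also have "\<sigma> * m * (\<eta> / 2 ^ k) + m / 4 * (1 / 2 ^ k) = m / 2 ^ k / 2"
          using \<sigma> by (simp add: \<eta>_def field_simps)
        finally show ?thesis by (simp add: m_def)
      qed
    qed (use v V \<sigma> in \<open>auto simp: dyadic_RH_def \<eta>_def\<close>)
  qed (use \<sigma> in \<open>simp add: \<eta>_def\<close>)
qed

text \<open>Both covering intervals have average at most \<open>exp e\<close>. Reverse Hoelder and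
  the covering cost \<open>4 * V\<close>, which enters \<open>C\<close> as
  \<open>ln (4 * V)\<close>. The coefficient \<open>6 * ln V\<close> is \<open>4 * ln V\<close> for
  comparing with the mean of \<open>ln v\<close> over the arc plus \<open>2 * ln V\<close> for the
  neighbour.\<close>

lemma dyadic_RH_arc_estimate:
  assumes p: "1 < p" and V: "2 \<le> V"
  obtains C A :: real where "0 \<le> A"
    and "\<And>v n j a l. \<lbrakk>dyadic_RH p V v; set_integrable lborel {0..<1} (\<lambda>x. ln (v x));
        a \<in> dyadic n j; a \<in> {0..<1}; l \<in> {0<..1}; l \<le> 1 / 2 ^ n; 1 < 2 * 2 ^ n * l\<rbrakk> \<Longrightarrow>
      Lp_mean_le p v (arc a l) (exp ((LINT x:arc a l|lborel. ln (v x)) / l + C + A * real (adj n j)))"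
proof -
  obtain \<eta> where \<eta>: "0 < \<eta>" and dw: "\<And>v. dyadic_RH p V v \<Longrightarrow> dyadic_weight v V \<eta>"
    using dyadic_RH_imp_dyadic_weight[OF p V] by blast
  define C where "C = ln (4 * V) + 4 * (ln (8 * V) / \<eta>)"
  show ?thesis
  proof (rule that[of "6 * ln V" C])
    fix v :: "real \<Rightarrow> real" and n j :: nat and a l :: real
    assume v: "dyadic_RH p V v" and ln_int: "set_integrable lborel {0..<1} (\<lambda>x. ln (v x))"
      and a: "a \<in> dyadic n j" "a \<in> {0..<1}" and l: "l \<in> {0<..1}" "l \<le> 1 / 2 ^ n" "1 < 2 * 2 ^ n * l"
    interpret dyadic_weight v V \<eta> by (rule dw[OF v])
    define j' where "j' = (j + 1) mod 2 ^ n"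
    define c where "c = (LINT x:arc a l|lborel. ln (v x)) / l"
    define e where "e = c + 4 * (ln (8 * V) / \<eta>) + 6 * ln V * real (adj n j)"
    have j: "j < 2 ^ n"
    proof -
      obtain i where "i < 2 ^ n" "a \<in> dyadic n i" using ex_dyadic_mem[OF a(2)] by blast
      then show ?thesis using a(1) dyadic_mem_unique by blast
    qed
    have j': "j' < 2 ^ n" by (simp add: j'_def)
    have pos: "0 < mn n j" "0 < mn n j'" using mn_pos j j' by auto
    have lnV: "0 \<le> ln V * real (adj n j)" using V by simp
    have "ln (mn n j) \<le> c + 4 * (ln (8 * V) / \<eta>) + 4 * ln V * real (adj n j)"
      unfolding c_def by (rule ln_mn_le_arc_average[OF a l ln_int])
    moreover have "\<bar>ln (mn n j') - ln (mn n j)\<bar> \<le> 2 * ln V * real (adj n j)"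
      unfolding j'_def by (rule ln_mn_adjacent[OF j])
    ultimately have "ln (mn n j) \<le> e" "ln (mn n j') \<le> e" using lnV by (auto simp: e_def)
    then have le: "mn n j \<le> exp e" "mn n j' \<le> exp e" using pos by (metis exp_le_cancel_iff exp_ln)+
    have Lp: "Lp_mean_le p v (dyadic n i) (V * exp e)" if "i < 2 ^ n" "mn n i \<le> exp e" for i
    proof (rule Lp_mean_le_mono[OF p])
      show "Lp_mean_le p v (dyadic n i) (V * mn n i)"
        using v that unfolding dyadic_RH_def mn_def by blast
      show "0 \<le> V * mn n i" using V mn_pos[OF that(1)] by simp
      show "V * mn n i \<le> V * exp e" using V that by simp
    qed
    have em: "emeasure lborel (dyadic n i) \<le> 2 * emeasure lborel (arc a l)" for i
    proof -
      have "ennreal (1 / 2 ^ n) \<le> ennreal (2 * l)" using l(3) by (intro ennreal_leI) (simp add: field_simps)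
      then show ?thesis using l by (simp add: emeasure_dyadic emeasure_arc[OF a(2) l(1)] ennreal_mult)
    qed
    have "Lp_mean_le p v (arc a l) (4 * (V * exp e))"
      using arc_subset_dyadic[OF a l(2)] V
      by (intro Lp_mean_le_cover[OF p, where J="dyadic n j" and J'="dyadic n j'"] Lp em j j' le) (auto simp: j'_def)
    moreover have "4 * (V * exp e) = exp (c + C + 6 * ln V * real (adj n j))"
    proof -
      have "4 * (V * exp e) = exp (ln (4 * V)) * exp e" using V by simp
      also have "\<dots> = exp (c + C + 6 * ln V * real (adj n j))"
        unfolding exp_add[symmetric] by (simp add: C_def e_def)
      finally show ?thesis .
    qed
    ultimately show "Lp_mean_le p v (arc a l)
        (exp ((LINT x:arc a l|lborel. ln (v x)) / l + C + 6 * ln V * real (adj n j)))"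
      by (simp add: c_def)
  qed (use V in simp)
qed

section \<open>From a Lebesgue measurable weight to a positive Borel representative\<close>

lemma set_integral_lebesgue_cong:
  fixes f g :: "real \<Rightarrow> real"
  assumes [measurable]: "E \<in> sets borel" "g \<in> borel_measurable borel"
    and f: "set_integrable lebesgue E f" and eq: "AE x in lborel. x \<in> E \<longrightarrow> f x = g x"
  shows "set_integrable lborel E g" "(LINT x:E|lebesgue. f x) = (LINT x:E|lborel. g x)"
proof -
  have AE: "AE x in lebesgue. indicat_real E x *\<^sub>R f x = indicat_real E x *\<^sub>R g x"
    using eq unfolding AE_completion_iff by eventually_elim (auto simp: indicator_def)
  have m: "(\<lambda>x. indicat_real E x *\<^sub>R g x) \<in> borel_measurable lborel" by measurable
  have "integrable lebesgue (\<lambda>x. indicat_real E x *\<^sub>R g x)"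
    using f[unfolded set_integrable_def] measurable_completion[OF m] AE by (rule integrable_cong_AE_imp)
  then show "set_integrable lborel E g"
    using integrable_completion[OF m] by (simp add: set_integrable_def)
  have "(LINT x:E|lebesgue. f x) = (LINT x:E|lebesgue. g x)"
    unfolding set_lebesgue_integral_def
    by (rule integral_cong_AE[OF borel_measurable_integrable[OF f[unfolded set_integrable_def]] measurable_completion[OF m] AE])
  then show "(LINT x:E|lebesgue. f x) = (LINT x:E|lborel. g x)"
    using integral_completion[OF m] by (simp add: set_lebesgue_integral_def)
qed

lemma RHd_le_imp_dyadic_RH:
  assumes p: "1 < p" and u: "RHd_le p u V" and [measurable]: "v \<in> borel_measurable borel"
    and vpos: "\<And>x. 0 < v x" and eq: "AE x in lborel. x \<in> {0..<1} \<longrightarrow> u x = v x"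
  shows "dyadic_RH p (max V 2) v"
proof -
  have ui: "set_integrable lebesgue {0..<1} u" using u by (simp add: RHd_le_def weight_def)
  have eqE: "AE x in lborel. x \<in> E \<longrightarrow> u x = v x" if "E \<subseteq> {0..<1}" for E
    using eq by eventually_elim (use that in auto)
  have uE: "(LINT x:E|lebesgue. u x) = (LINT x:E|lborel. v x)" if "E \<in> sets borel" "E \<subseteq> {0..<1}" for E
    using that set_integrable_subset[OF ui _ that(2)]
    by (intro set_integral_lebesgue_cong eqE) auto
  have v0: "0 \<le> (LINT x:E|lborel. v x)" for E
    unfolding set_lebesgue_integral_def using less_imp_le[OF vpos] by (intro integral_nonneg_AE) auto
  have "(LINT x:dyadic k (j div 2)|lborel. v x) \<le> max V 2 * (LINT x:dyadic (Suc k) j|lborel. v x)"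
    if j: "j < 2 ^ Suc k" for k j
  proof -
    have jd: "j div 2 < 2 ^ k" using j by auto
    have "(LINT x:dyadic k (j div 2)|lebesgue. u x) \<le> V * (LINT x:dyadic (Suc k) j|lebesgue. u x)"
      using u j unfolding RHd_le_def by (metis diff_Suc_1 zero_less_Suc)
    also have "\<dots> \<le> max V 2 * (LINT x:dyadic (Suc k) j|lebesgue. u x)"
      using v0 uE[OF dyadic_sets dyadic_subset_unit[OF j]] by (intro mult_right_mono) auto
    finally show ?thesis
      using uE[OF dyadic_sets dyadic_subset_unit[OF j]] uE[OF dyadic_sets dyadic_subset_unit[OF jd]] by simp
  qed
  moreover have "Lp_mean_le p v (dyadic k j) (max V 2 * (2 ^ k * (LINT x:dyadic k j|lborel. v x)))"
    if j: "j < 2 ^ k" for k j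
  proof -
    let ?J = "dyadic k j"
    define m where "m = 2 ^ k * (LINT x:?J|lborel. v x)"
    have m: "0 \<le> m" using v0 by (simp add: m_def)
    have J: "rh_ineq p ?J u V" using u j by (simp add: RHd_le_def)
    have avg: "avg ?J f = 2 ^ k * (LINT x:?J|lebesgue. f x)" for f
      by (simp add: avg_def)
    have am: "avg ?J u = m" using uE[OF dyadic_sets dyadic_subset_unit[OF j]] by (simp add: avg m_def)
    have Vm: "V * m \<le> max V 2 * m" using m by (intro mult_right_mono) auto
    have eqJ: "AE x in lborel. x \<in> ?J \<longrightarrow> u x = v x" by (rule eqE[OF dyadic_subset_unit[OF j]])
    show ?thesis
      unfolding m_def[symmetric] using p
    proof (cases rule: ereal_gt_one_cases)
      case inf
      have "AE x in lborel. x \<in> ?J \<longrightarrow> u x \<le> V * m"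
        using J by (simp add: inf rh_ineq_def am AE_completion_iff)
      then have "AE x in lborel. x \<in> ?J \<longrightarrow> v x \<le> max V 2 * m"
        using eqJ by eventually_elim (use Vm in auto)
      then show "Lp_mean_le p v ?J (max V 2 * m)" by (simp add: inf Lp_mean_le_def)
    next
      case (real r)
      have ur: "set_integrable lebesgue ?J (\<lambda>x. u x powr r)" "avg ?J (\<lambda>x. u x powr r) powr (1 / r) \<le> V * m"
        using J by (auto simp: real rh_ineq_def am)
      have eqr: "AE x in lborel. x \<in> ?J \<longrightarrow> u x powr r = v x powr r"
        using eqJ by eventually_elim auto
      have vr: "set_integrable lborel ?J (\<lambda>x. v x powr r)"
        "(LINT x:?J|lebesgue. u x powr r) = (LINT x:?J|lborel. v x powr r)"
        using set_integral_lebesgue_cong[OF _ _ ur(1) eqr] by auto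
      have nn: "0 \<le> avg ?J (\<lambda>x. u x powr r)"
        unfolding avg set_lebesgue_integral_def by (intro mult_nonneg_nonneg integral_nonneg_AE) auto
      have "avg ?J (\<lambda>x. u x powr r) = (avg ?J (\<lambda>x. u x powr r) powr (1 / r)) powr r"
        using nn real by (simp add: powr_powr)
      also have "\<dots> \<le> (max V 2 * m) powr r"
        using ur(2) Vm real by (intro powr_mono2) auto
      finally have "(LINT x:?J|lborel. v x powr r) \<le> (max V 2 * m) powr r * (1 / 2 ^ k)"
        by (simp add: avg vr field_simps)
      moreover have "(\<integral>\<^sup>+x\<in>?J. ennreal (v x powr r) \<partial>lborel) = ennreal (LINT x:?J|lborel. v x powr r)"
        using vr(1) unfolding set_lebesgue_integral_def set_integrable_def
        by (subst nn_integral_eq_integral[symmetric]) (auto intro!: nn_integral_cong simp: indicator_def)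
      ultimately show "Lp_mean_le p v ?J (max V 2 * m)"
        by (simp add: real Lp_mean_le_def emeasure_dyadic ennreal_mult[symmetric] ennreal_leI)
    qed
  qed
  moreover have "set_integrable lborel {0..<1} v"
    by (rule set_integral_lebesgue_cong(1)[OF _ _ ui eq]) auto
  ultimately show ?thesis using vpos by (simp add: dyadic_RH_def)
qed

subsection \<open>Geometric means over the circle\<close>

interpretation circ: finite_measure circ
  by (rule finite_measure_circ)

interpretation circ2: pair_sigma_finite circ circ ..

lemma circ_pair_measurable:
  assumes "f \<in> borel_measurable (borel \<Otimes>\<^sub>M borel)"
  shows "f \<in> borel_measurable (circ \<Otimes>\<^sub>M circ)"
proof -
  have "(\<lambda>x. x) \<in> circ \<rightarrow>\<^sub>M borel" by (rule borel_measurable_circ) simp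
  then have "(\<lambda>z. (fst z, snd z)) \<in> circ \<Otimes>\<^sub>M circ \<rightarrow>\<^sub>M borel \<Otimes>\<^sub>M borel"
    by (intro measurable_Pair measurable_compose[OF measurable_fst] measurable_compose[OF measurable_snd])
  from measurable_compose[OF this assms] show ?thesis by simp
qed

lemma integrable_circ: "integrable circ f \<longleftrightarrow> set_integrable lborel {0..<1} f" for f :: "real \<Rightarrow> real"
  unfolding circ_def set_integrable_def by (rule integrable_restrict_space) simp

lemma integral_circ:
  fixes f :: "real \<Rightarrow> real"
  shows "(\<integral>x. f x \<partial>circ) = (LINT x:{0..<1}|lborel. f x)"
  unfolding circ_def set_lebesgue_integral_def by (rule integral_restrict_space) simp

lemma set_integral_circ:
  fixes f :: "real \<Rightarrow> real"
  assumes "E \<subseteq> {0..<1}"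
  shows "(LINT x:E|lborel. f x) = (\<integral>x. indicator E x * f x \<partial>circ)"
  unfolding integral_circ set_lebesgue_integral_def
  using assms by (intro Bochner_Integration.integral_cong) (auto simp: indicator_def)

lemma set_nn_integral_circ:
  assumes "E \<subseteq> {0..<1}"
  shows "(\<integral>\<^sup>+x\<in>E. f x \<partial>lborel) = (\<integral>\<^sup>+x. f x * indicator E x \<partial>circ)"
  unfolding nn_integral_circ using assms by (intro nn_integral_cong) (auto simp: indicator_def)

lemma AE_lborel_circ:
  assumes "E \<subseteq> {0..<1}"
  shows "(AE x in lborel. x \<in> E \<longrightarrow> P x) \<longleftrightarrow> (AE x in circ. x \<in> E \<longrightarrow> P x)"
  unfolding AE_circ using assms by (intro AE_cong) auto

text \<open>Jensen's inequality, obtained by integrating the tangent line of \<open>exp\<close> at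
  the mean. It is applied in \<open>t\<close> with total mass 1 and in \<open>x\<close> on an arc of
  mass \<open>l\<close>; the nonnegative integral admits an infinite right-hand side.\<close>

lemma exp_mean_le:
  assumes M: "finite_measure M" and \<mu>: "0 < measure M (space M)" and f: "integrable M f"
  shows "ennreal (exp ((\<integral>x. f x \<partial>M) / measure M (space M)) * measure M (space M)) \<le> (\<integral>\<^sup>+x. ennreal (exp (f x)) \<partial>M)"
proof (cases "(\<integral>\<^sup>+x. ennreal (exp (f x)) \<partial>M) = \<infinity>")
  case False
  interpret finite_measure M by (rule M)
  let ?\<mu> = "measure M (space M)"
  define m where "m = (\<integral>x. f x \<partial>M) / ?\<mu>"
  have [measurable]: "f \<in> borel_measurable M" using f by simp
  have int: "integrable M (\<lambda>x. exp (f x))"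
    using False by (intro integrableI_bounded) (auto simp: less_top)
  have "exp m * ?\<mu> = (\<integral>x. exp m * (1 + (f x - m)) \<partial>M)"
    using f \<mu> by (simp add: m_def field_simps)
  also have "\<dots> \<le> (\<integral>x. exp (f x) \<partial>M)"
  proof (rule integral_mono)
    fix x
    have "exp m * (1 + (f x - m)) \<le> exp m * exp (f x - m)"
      by (intro mult_left_mono exp_ge_add_one_self) simp
    then show "exp m * (1 + (f x - m)) \<le> exp (f x)" by (simp flip: exp_add)
  qed (use f int in auto)
  finally show ?thesis
    using int by (subst nn_integral_eq_integral) (auto simp: m_def intro!: ennreal_leI)
qed simp

text \<open>Jensen in \<open>t\<close> is applied to \<open>r * (G t x - R t)\<close>, not to
  \<open>r * G t x\<close>. After normalisation each \<open>t\<close> contributes at most the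
  measure of \<open>Q\<close>, so \<open>R\<close> enters only through its integral and
  \<open>exp (R t)\<close> need not be integrable. For infinite \<open>p\<close> the pointwise bound
  is integrated in \<open>t\<close> after exchanging the two almost-everywhere quantifiers.\<close>

lemma Lp_mean_le_geometric_mean:
  fixes G :: "real \<Rightarrow> real \<Rightarrow> real"
  assumes p: "1 < p" and [measurable]: "case_prod G \<in> borel_measurable (borel \<Otimes>\<^sub>M borel)"
    and G: "integrable (circ \<Otimes>\<^sub>M circ) (case_prod G)" and R: "integrable circ R"
    and Q [measurable]: "Q \<in> sets borel" and Q01: "Q \<subseteq> {0..<1}"
    and le: "AE t in circ. Lp_mean_le p (\<lambda>x. exp (G t x)) Q (exp (R t))"
  shows "Lp_mean_le p (\<lambda>x. exp (\<integral>t. G t x \<partial>circ)) Q (exp (\<integral>t. R t \<partial>circ))"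
proof -
  have [measurable]: "R \<in> borel_measurable circ" using R by simp
  have G2 [measurable]: "case_prod G \<in> borel_measurable (circ \<Otimes>\<^sub>M circ)" using G by simp
  have Qc [measurable]: "Q \<in> sets circ" using Q Q01 by (simp add: sets_circ)
  have Gint: "AE x in circ. integrable circ (\<lambda>t. G t x)"
    using circ2.AE_integrable_snd[OF G] .
  show ?thesis
    using p
  proof (cases rule: ereal_gt_one_cases)
    case inf
    have "AE t in circ. AE x in circ. x \<in> Q \<longrightarrow> G t x \<le> R t"
      using le by (simp add: inf Lp_mean_le_def AE_lborel_circ[OF Q01])
    also have "?this \<longleftrightarrow> (AE x in circ. AE t in circ. x \<in> Q \<longrightarrow> G t x \<le> R t)"
      by (rule circ2.AE_commute) measurable
    finally have "AE x in circ. x \<in> Q \<longrightarrow> exp (\<integral>t. G t x \<partial>circ) \<le> exp (\<integral>t. R t \<partial>circ)"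
      using Gint
    proof eventually_elim
      case (elim x)
      then show ?case using R by (auto intro!: integral_mono_AE)
    qed
    then show ?thesis by (simp add: inf Lp_mean_le_def AE_lborel_circ[OF Q01])
  next
    case (real r)
    let ?K = "exp (r * (\<integral>t. R t \<partial>circ))"
    have pw: "exp y powr r = exp (r * y)" for y :: real by (simp add: powr_def)
    have "(\<integral>\<^sup>+x\<in>Q. ennreal (exp (\<integral>t. G t x \<partial>circ) powr r) \<partial>lborel)
        = (\<integral>\<^sup>+x. ennreal (exp (r * (\<integral>t. G t x \<partial>circ))) * indicator Q x \<partial>circ)"
      by (simp add: set_nn_integral_circ[OF Q01] pw)
    also have "\<dots> \<le> (\<integral>\<^sup>+x. ennreal ?K * (\<integral>\<^sup>+t. ennreal (exp (r * (G t x - R t))) * indicator Q x \<partial>circ) \<partial>circ)"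
    proof (rule nn_integral_mono_AE)
      show "AE x in circ. ennreal (exp (r * (\<integral>t. G t x \<partial>circ))) * indicator Q x
          \<le> ennreal ?K * (\<integral>\<^sup>+t. ennreal (exp (r * (G t x - R t))) * indicator Q x \<partial>circ)"
        using Gint
      proof eventually_elim
        case (elim x)
        have "ennreal (exp (r * (\<integral>t. G t x \<partial>circ))) = ennreal ?K * ennreal (exp (\<integral>t. r * (G t x - R t) \<partial>circ))"
          using elim R by (simp add: ennreal_mult[symmetric] exp_add[symmetric] algebra_simps)
        also have "ennreal (exp (\<integral>t. r * (G t x - R t) \<partial>circ)) \<le> (\<integral>\<^sup>+t. ennreal (exp (r * (G t x - R t))) \<partial>circ)"
          using exp_mean_le[OF finite_measure_circ, of "\<lambda>t. r * (G t x - R t)"] elim R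
          by (simp add: measure_def)
        finally show ?case by (simp add: indicator_def mult_left_mono)
      qed
    qed
    also have "\<dots> = ennreal ?K * (\<integral>\<^sup>+x. (\<integral>\<^sup>+t. ennreal (exp (r * (G t x - R t))) * indicator Q x \<partial>circ) \<partial>circ)"
      by (rule nn_integral_cmult) measurable
    also have "(\<integral>\<^sup>+x. (\<integral>\<^sup>+t. ennreal (exp (r * (G t x - R t))) * indicator Q x \<partial>circ) \<partial>circ)
        = (\<integral>\<^sup>+t. (\<integral>\<^sup>+x. ennreal (exp (r * (G t x - R t))) * indicator Q x \<partial>circ) \<partial>circ)"
      by (rule circ2.Fubini') measurable
    also have "\<dots> \<le> (\<integral>\<^sup>+t. emeasure lborel Q \<partial>circ)"
    proof (rule nn_integral_mono_AE)
      show "AE t in circ. (\<integral>\<^sup>+x. ennreal (exp (r * (G t x - R t))) * indicator Q x \<partial>circ) \<le> emeasure lborel Q"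
        using le AE_space
      proof eventually_elim
        case (elim t)
        have [measurable]: "(\<lambda>x. G t x) \<in> borel_measurable circ"
          using measurable_Pair2[OF G2 elim(2)] by simp
        have "(\<integral>\<^sup>+x. ennreal (exp (r * (G t x - R t))) * indicator Q x \<partial>circ)
            = (\<integral>\<^sup>+x. ennreal (exp (- r * R t)) * (ennreal (exp (r * G t x)) * indicator Q x) \<partial>circ)"
          by (intro nn_integral_cong) (simp add: right_diff_distrib exp_diff exp_minus divide_inverse
              ennreal_mult mult_ac)
        also have "\<dots> = ennreal (exp (- r * R t)) * (\<integral>\<^sup>+x. ennreal (exp (r * G t x)) * indicator Q x \<partial>circ)"
          by (rule nn_integral_cmult) measurable
        also have "\<dots> \<le> ennreal (exp (- r * R t)) * (ennreal (exp (r * R t)) * emeasure lborel Q)"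
          using elim(1) by (intro mult_left_mono) (simp_all add: real Lp_mean_le_def pw set_nn_integral_circ[OF Q01])
        also have "\<dots> = emeasure lborel Q"
          by (simp add: mult.assoc[symmetric] ennreal_mult[symmetric] exp_add[symmetric])
        finally show ?case .
      qed
    qed
    also have "\<dots> = emeasure lborel Q" by simp
    finally show ?thesis by (simp add: real Lp_mean_le_def pw mult_left_mono)
  qed
qed

lemma Lp_mean_le_rotate:
  assumes p: "1 < p" and [measurable]: "v \<in> borel_measurable borel"
    and t: "t \<in> {0..1}" and a: "a \<in> {0..<1}" and l: "l \<in> {0<..1}"
    and le: "Lp_mean_le p v (arc (frac (a + t)) l) K"
  shows "Lp_mean_le p (\<lambda>x. v (frac (x + t))) (arc a l) K"
  using p
proof (cases rule: ereal_gt_one_cases)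
  case inf
  have "AE x in circ. x \<in> arc (frac (a + t)) l \<longrightarrow> v x \<le> K"
    using le by (simp add: inf Lp_mean_le_def AE_lborel_circ[OF arc_subset])
  from AE_rotation[OF t this] have "AE x in circ. x \<in> arc a l \<longrightarrow> v (frac (x + t)) \<le> K"
    using AE_space by eventually_elim (simp add: arc_rotate)
  then show ?thesis by (simp add: inf Lp_mean_le_def AE_lborel_circ[OF arc_subset])
next
  case (real r)
  have fr: "frac (a + t) \<in> {0..<1}" by (simp add: frac_lt_1)
  have "(\<integral>\<^sup>+x\<in>arc a l. ennreal (v (frac (x + t)) powr r) \<partial>lborel)
      = (\<integral>\<^sup>+x. ennreal (v (frac (x + t)) powr r) * indicator (arc (frac (a + t)) l) (frac (x + t)) \<partial>circ)"
    unfolding set_nn_integral_circ[OF arc_subset]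
    by (intro nn_integral_cong) (simp add: arc_rotate indicator_def)
  also have "\<dots> = (\<integral>\<^sup>+x. ennreal (v x powr r) * indicator (arc (frac (a + t)) l) x \<partial>circ)"
    by (rule nn_integral_rotation[OF t, of "\<lambda>x. ennreal (v x powr r) * indicator (arc (frac (a + t)) l) x"]) measurable
  also have "\<dots> \<le> ennreal (K powr r) * emeasure lborel (arc a l)"
    using le by (simp add: real Lp_mean_le_def set_nn_integral_circ[OF arc_subset] emeasure_arc[OF a l] emeasure_arc[OF fr l])
  finally show ?thesis by (simp add: real Lp_mean_le_def)
qed

text \<open>\<open>h\<close> takes the value \<open>adj n j\<close> on \<open>dyadic n j\<close>. As
  \<open>t\<close> runs over the circle, \<open>frac (t + a)\<close> is uniformly distributed, so
  the integral is the mean of \<open>adj n\<close> over all \<open>j\<close>.\<close>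

lemma integral_adj:
  fixes n :: nat
  assumes a: "a \<in> {0..<1}"
  defines "h \<equiv> \<lambda>y. \<Sum>j<2 ^ n. real (adj n j) * indicat_real (dyadic n j) y"
  shows "integrable circ (\<lambda>t. h (frac (t + a)))" "(\<integral>t. h (frac (t + a)) \<partial>circ) \<le> 2"
    and "y \<in> dyadic n j \<Longrightarrow> j < 2 ^ n \<Longrightarrow> h y = real (adj n j)"
proof -
  show "integrable circ (\<lambda>t. h (frac (t + a)))"
    unfolding h_def
    by (intro Bochner_Integration.integrable_sum integrable_mult_right circ.integrable_const_bound[where B=1]
        borel_measurable_circ) (auto simp: indicator_def)
  have ind: "integrable circ (indicat_real (dyadic n j))" for j
    by (intro circ.integrable_const_bound[where B=1] borel_measurable_circ) auto
  have [measurable]: "h \<in> borel_measurable borel" unfolding h_def by measurable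
  have "(\<integral>t. h (frac (t + a)) \<partial>circ) = (\<integral>t. h t \<partial>circ)"
    using a by (intro integral_rotation) auto
  also have "\<dots> = (\<Sum>j<2 ^ n. real (adj n j) * (\<integral>t. indicat_real (dyadic n j) t \<partial>circ))"
    unfolding h_def
    by (subst Bochner_Integration.integral_sum) (auto simp: ind)
  also have "\<dots> = (\<Sum>j<2 ^ n. real (adj n j) * (1 / 2 ^ n))"
  proof (rule sum.cong[OF refl])
    fix j :: nat assume "j \<in> {..<2 ^ n}"
    then have "(\<integral>t. indicat_real (dyadic n j) t \<partial>circ) = (LINT x:dyadic n j|lborel. 1)"
      using dyadic_subset_unit[of j n] by (subst set_integral_circ) auto
    also have "\<dots> = 1 / 2 ^ n" by (simp add: set_lebesgue_integral_def)
    finally show "real (adj n j) * (\<integral>t. indicat_real (dyadic n j) t \<partial>circ) = real (adj n j) * (1 / 2 ^ n)" by simp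
  qed
  also have "\<dots> = real (\<Sum>j<2 ^ n. adj n j) / 2 ^ n" by (simp add: sum_divide_distrib)
  also have "\<dots> \<le> real (2 * 2 ^ n) / 2 ^ n"
    using sum_adj[of n] by (intro divide_right_mono) (simp_all only: of_nat_le_iff, simp)
  finally show "(\<integral>t. h (frac (t + a)) \<partial>circ) \<le> 2" by simp
  assume y: "y \<in> dyadic n j" "j < 2 ^ n"
  have "h y = (\<Sum>i<2 ^ n. if i = j then real (adj n j) else 0)"
    unfolding h_def using y(1) by (intro sum.cong) (auto simp: indicator_def dest: dyadic_mem_unique)
  then show "h y = real (adj n j)" using y by simp
qed

text \<open>\<open>n\<close> is the predecessor of the least exponent whose power of 1/2 falls below
  \<open>l\<close>; that exponent is not 0 because \<open>l \<le> 1\<close>.\<close>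

lemma ex_dyadic_scale:
  assumes "l \<in> {0<..1::real}"
  obtains n where "l \<le> 1 / 2 ^ n" "1 < 2 * 2 ^ n * l"
proof -
  obtain m where m: "(1/2) ^ m < l" using real_arch_pow_inv[of l "1/2"] assms by auto
  define N where "N = (LEAST m. (1/2) ^ m < l)"
  have N: "(1/2) ^ N < l" unfolding N_def using m by (rule LeastI)
  have "N \<noteq> 0" using N assms by (intro notI) simp
  then obtain n where n: "N = Suc n" using not0_implies_Suc by blast
  then have "\<not> (1/2) ^ n < l" using not_less_Least[of n "\<lambda>m. (1/2) ^ m < l"] by (simp add: N_def)
  then have "l \<le> 1 / 2 ^ n" by (simp add: power_one_over)
  moreover have "1 < 2 * 2 ^ n * l" using N by (simp add: n power_one_over field_simps)
  ultimately show ?thesis using that by blast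
qed

text \<open>For finite \<open>p\<close> this rests on \<open>w \<le> 1 + w powr r\<close>. It
  supplies the integrability of \<open>\<Omega>\<close>, which is not known beforehand, from the
  estimate on the full circle.\<close>

lemma set_integrable_of_Lp_mean_le:
  assumes p: "1 < p" and [measurable]: "w \<in> borel_measurable borel" and w: "\<And>x. 0 \<le> w x"
    and [measurable]: "E \<in> sets borel" and E: "emeasure lborel E < \<infinity>" and le: "Lp_mean_le p w E K"
  shows "set_integrable lborel E w"
proof -
  have fin: "(\<integral>\<^sup>+x. ennreal c * indicator E x \<partial>lborel) < \<infinity>" for c
    using E by (simp add: nn_integral_cmult_indicator ennreal_mult_less_top)
  have "(\<integral>\<^sup>+x\<in>E. ennreal (w x) \<partial>lborel) < \<infinity>"
    using p
  proof (cases rule: ereal_gt_one_cases)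
    case inf
    have "AE x in lborel. x \<in> E \<longrightarrow> w x \<le> K" using le by (simp add: inf Lp_mean_le_def)
    then have "(\<integral>\<^sup>+x\<in>E. ennreal (w x) \<partial>lborel) \<le> (\<integral>\<^sup>+x. ennreal K * indicator E x \<partial>lborel)"
      by (intro nn_integral_mono_AE, elim eventually_mono) (auto simp: indicator_def intro!: ennreal_leI)
    then show ?thesis using fin[of K] by (rule order_le_less_trans)
  next
    case (real r)
    have "w x \<le> 1 + w x powr r" for x
    proof (cases "w x \<le> 1")
      case False
      then have "w x powr 1 \<le> w x powr r" using real by (intro powr_mono) auto
      then show ?thesis using False by simp
    qed (simp add: add_increasing2)
    then have "ennreal (w x) \<le> ennreal 1 + ennreal (w x powr r)" for x
      by (subst ennreal_plus[symmetric]) (auto intro!: ennreal_leI simp del: ennreal_plus)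
    then have "(\<integral>\<^sup>+x\<in>E. ennreal (w x) \<partial>lborel)
        \<le> (\<integral>\<^sup>+x. ennreal 1 * indicator E x + ennreal (w x powr r) * indicator E x \<partial>lborel)"
      by (intro nn_integral_mono) (auto simp: indicator_def)
    also have "\<dots> = (\<integral>\<^sup>+x. ennreal 1 * indicator E x \<partial>lborel) + (\<integral>\<^sup>+x\<in>E. ennreal (w x powr r) \<partial>lborel)"
      by (rule nn_integral_add) auto
    also have "(\<integral>\<^sup>+x\<in>E. ennreal (w x powr r) \<partial>lborel) \<le> ennreal (K powr r) * emeasure lborel E"
      using le by (simp add: real Lp_mean_le_def)
    also have "(\<integral>\<^sup>+x. ennreal 1 * indicator E x \<partial>lborel) + ennreal (K powr r) * emeasure lborel E < \<infinity>"
      using fin[of 1] E by (simp add: ennreal_mult_less_top)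
    finally show ?thesis by (simp add: add_left_mono)
  qed
  then show ?thesis
    unfolding set_integrable_def using w
    by (intro integrableI_bounded) (auto simp: ennreal_mult mult.commute ennreal_indicator)
qed

subsection \<open>The reverse Hoelder inequality for the geometric average\<close>

text \<open>The final constant is \<open>exp (C + 2 * A)\<close>: \<open>C\<close> and
  \<open>A\<close> come from the estimate on a single arc, and 2 bounds the mean of
  \<open>adj\<close> over all rotations.\<close>

lemma geometric_average_RH:
  assumes p: "1 < p" and V: "2 \<le> V"
  obtains C :: real where "0 < C" and
    "\<And>g \<Omega>. \<lbrakk>g \<in> borel_measurable (borel \<Otimes>\<^sub>M borel); \<forall>z. 0 < g z;
      AE t in circ. dyadic_RH p V (\<lambda>x. g (t, x));
      (\<integral>\<^sup>+t. (\<integral>\<^sup>+x. ennreal \<bar>ln (g (t, x))\<bar> \<partial>circ) \<partial>circ) < \<infinity>;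
      \<Omega> = (\<lambda>x. exp (\<integral>t. ln (g (t, frac (x + t))) \<partial>circ))\<rbrakk> \<Longrightarrow>
      \<Omega> \<in> borel_measurable borel \<and> set_integrable lborel {0..<1} \<Omega> \<and>
      (\<forall>a\<in>{0..<1}. \<forall>l\<in>{0<..1}. Lp_mean_le p \<Omega> (arc a l) (C * ((LINT x:arc a l|lborel. \<Omega> x) / l)))"
proof -
  obtain C A :: real where A: "0 \<le> A" and est: "\<And>v n j a l. \<lbrakk>dyadic_RH p V v; set_integrable lborel {0..<1} (\<lambda>x. ln (v x));
        a \<in> dyadic n j; a \<in> {0..<1}; l \<in> {0<..1}; l \<le> 1 / 2 ^ n; 1 < 2 * 2 ^ n * l\<rbrakk> \<Longrightarrow>
      Lp_mean_le p v (arc a l) (exp ((LINT x:arc a l|lborel. ln (v x)) / l + C + A * real (adj n j)))"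
    by (rule dyadic_RH_arc_estimate[OF p V]) (rule that)
  show ?thesis
  proof (rule that[of "exp (C + 2 * A)"], goal_cases)
    case (2 g \<Omega>)
    note g [measurable] = 2(1) and gpos = 2(2)[rule_format] and RH = 2(3) and fin = 2(4) and \<Omega> = 2(5)
    have [measurable]: "(frac :: real \<Rightarrow> real) \<in> borel_measurable borel"
      unfolding frac_def by measurable
    define G where "G t x = ln (g (t, frac (x + t)))" for t x
    have G_borel [measurable]: "case_prod G \<in> borel_measurable (borel \<Otimes>\<^sub>M borel)"
      unfolding G_def by measurable
    have G_circ [measurable]: "case_prod G \<in> borel_measurable (circ \<Otimes>\<^sub>M circ)"
      by (rule circ_pair_measurable[OF G_borel])
    have g_circ [measurable]: "(\<lambda>z. g z) \<in> borel_measurable (circ \<Otimes>\<^sub>M circ)"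
      by (rule circ_pair_measurable) simp
    have g_slice [measurable]: "(\<lambda>x. g (t, x)) \<in> borel_measurable borel" for t by measurable
    have "(\<integral>\<^sup>+z. ennreal (norm (case_prod G z)) \<partial>(circ \<Otimes>\<^sub>M circ)) = (\<integral>\<^sup>+t. (\<integral>\<^sup>+x. ennreal \<bar>G t x\<bar> \<partial>circ) \<partial>circ)"
      by (subst circ.nn_integral_fst[symmetric]) auto
    also have "\<dots> = (\<integral>\<^sup>+t. (\<integral>\<^sup>+x. ennreal \<bar>ln (g (t, x))\<bar> \<partial>circ) \<partial>circ)"
    proof (rule nn_integral_cong)
      fix t assume "t \<in> space circ"
      then show "(\<integral>\<^sup>+x. ennreal \<bar>G t x\<bar> \<partial>circ) = (\<integral>\<^sup>+x. ennreal \<bar>ln (g (t, x))\<bar> \<partial>circ)"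
        unfolding G_def by (intro nn_integral_rotation[of t "\<lambda>x. ennreal \<bar>ln (g (t, x))\<bar>"]) auto
    qed
    finally have G: "integrable (circ \<Otimes>\<^sub>M circ) (case_prod G)"
      using fin by (intro integrableI_bounded G_circ) simp
    have ln_int: "AE t in circ. set_integrable lborel {0..<1} (\<lambda>x. ln (g (t, x)))"
    proof -
      have "AE t in circ. (\<integral>\<^sup>+x. ennreal \<bar>ln (g (t, x))\<bar> \<partial>circ) \<noteq> \<infinity>"
        using fin by (intro nn_integral_PInf_AE) auto
      then show ?thesis
        unfolding integrable_circ[symmetric]
        by eventually_elim (auto intro!: integrableI_bounded borel_measurable_circ simp: less_top)
    qed
    define F where "F x = (\<integral>t. G t x \<partial>circ)" for x
    have \<Omega>F: "\<Omega> = (\<lambda>x. exp (F x))" by (simp add: \<Omega> F_def G_def)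
    have [measurable]: "F \<in> borel_measurable borel"
    proof -
      have "(\<lambda>x. x) \<in> circ \<rightarrow>\<^sub>M borel" by (rule borel_measurable_circ) simp
      then have "(\<lambda>z. (snd z, fst z)) \<in> borel \<Otimes>\<^sub>M circ \<rightarrow>\<^sub>M borel \<Otimes>\<^sub>M borel"
        by (intro measurable_Pair measurable_compose[OF measurable_snd] measurable_fst)
      from measurable_compose[OF this G_borel] have "(\<lambda>(x, t). G t x) \<in> borel_measurable (borel \<Otimes>\<^sub>M circ)"
        by (simp add: case_prod_beta)
      then show ?thesis unfolding F_def by (rule circ.borel_measurable_lebesgue_integral)
    qed
    have F_int: "integrable circ F" unfolding F_def by (rule circ2.integrable_snd[OF G])
    have \<Omega>_borel [measurable]: "\<Omega> \<in> borel_measurable borel" unfolding \<Omega>F by measurable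
    have key: "Lp_mean_le p \<Omega> (arc a l) (exp ((LINT x:arc a l|lborel. F x) / l + (C + 2 * A)))"
      if a: "a \<in> {0..<1}" and l: "l \<in> {0<..1}" for a l
    proof -
      let ?Q = "arc a l"
      \<comment> \<open>Rotation preserves the length of the arc, so one generation \<open>n\<close>
        serves every \<open>t\<close>; only the starting interval varies.\<close>
      obtain n where n: "l \<le> 1 / 2 ^ n" "1 < 2 * 2 ^ n * l" using ex_dyadic_scale[OF l] by blast
      define h where "h y = (\<Sum>j<2 ^ n. real (adj n j) * indicat_real (dyadic n j) y)" for y
      note h = integral_adj[where n = n, OF a, folded h_def]
      \<comment> \<open>This is the mean of \<open>ln (g (t, x))\<close> over the arc rotated by
        \<open>t\<close>. Writing it over the fixed arc \<open>?Q\<close> lets Fubini turn its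
        integral in \<open>t\<close> into the mean of \<open>F\<close>.\<close>
      define c where "c t = (\<integral>x. indicator ?Q x * G t x \<partial>circ) / l" for t
      have GQ: "integrable (circ \<Otimes>\<^sub>M circ) (\<lambda>(t, x). indicator ?Q x * G t x)"
      proof (rule Bochner_Integration.integrable_bound[OF G])
        have "(\<lambda>(t, x). indicat_real ?Q x * G t x) \<in> borel_measurable (borel \<Otimes>\<^sub>M borel)" by measurable
        then show "(\<lambda>(t, x). indicat_real ?Q x * G t x) \<in> borel_measurable (circ \<Otimes>\<^sub>M circ)"
          by (rule circ_pair_measurable)
      qed (auto simp: indicator_def)
      have c_int: "integrable circ c"
        unfolding c_def using circ2.integrable_fst[OF GQ] by simp
      have c_eq: "(\<integral>t. c t \<partial>circ) = (LINT x:?Q|lborel. F x) / l"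
        using circ2.Fubini_integral[OF GQ] by (simp add: c_def set_integral_circ[OF arc_subset] F_def)
      define R where "R t = c t + C + A * h (frac (t + a))" for t
      have R_int: "integrable circ R" unfolding R_def using c_int h(1) by simp
      have "AE t in circ. Lp_mean_le p (\<lambda>x. exp (G t x)) ?Q (exp (R t))"
        using RH ln_int AE_space
      proof eventually_elim
        case (elim t)
        then have t: "t \<in> {0..1}" by simp
        have fr: "frac (a + t) \<in> {0..<1}" by (simp add: frac_lt_1)
        obtain j where j: "j < 2 ^ n" "frac (a + t) \<in> dyadic n j" using ex_dyadic_mem[OF fr] by blast
        have "c t = (LINT x:arc (frac (a + t)) l|lborel. ln (g (t, x))) / l"
        proof -
          have "(\<integral>x. indicator ?Q x * G t x \<partial>circ)
              = (\<integral>x. indicator (arc (frac (a + t)) l) (frac (x + t)) * ln (g (t, frac (x + t))) \<partial>circ)"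
            unfolding G_def by (intro Bochner_Integration.integral_cong) (simp_all add: arc_rotate indicator_def)
          also have "\<dots> = (\<integral>x. indicator (arc (frac (a + t)) l) x * ln (g (t, x)) \<partial>circ)"
            by (rule integral_rotation[OF t, of "\<lambda>x. indicator (arc (frac (a + t)) l) x * ln (g (t, x))"]) measurable
          finally show ?thesis by (simp add: c_def set_integral_circ[OF arc_subset])
        qed
        then have "Lp_mean_le p (\<lambda>x. g (t, x)) (arc (frac (a + t)) l) (exp (R t))"
          using est[OF elim(1,2) j(2) fr l n] h(3)[OF j(2,1)] by (simp add: R_def add.commute[of t a])
        then have "Lp_mean_le p (\<lambda>x. g (t, frac (x + t))) ?Q (exp (R t))"
          by (rule Lp_mean_le_rotate[OF p g_slice t a l])
        then show ?case using gpos by (simp add: G_def)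
      qed
      then have "Lp_mean_le p \<Omega> ?Q (exp (\<integral>t. R t \<partial>circ))"
        unfolding \<Omega>F F_def by (rule Lp_mean_le_geometric_mean[OF p G_borel G R_int arc_sets arc_subset])
      moreover have "(\<integral>t. R t \<partial>circ) = (\<integral>t. c t \<partial>circ) + C + A * (\<integral>t. h (frac (t + a)) \<partial>circ)"
        unfolding R_def using c_int h(1) by (simp add: measure_def)
      then have "(\<integral>t. R t \<partial>circ) \<le> (LINT x:?Q|lborel. F x) / l + (C + 2 * A)"
        using h(2) mult_left_mono[OF h(2) A] by (simp add: c_eq)
      ultimately show ?thesis by - (rule Lp_mean_le_mono[OF p], assumption, auto)
    qed
    have arc01: "arc 0 1 = {0..<1}" by (auto simp: arc_def frac_lt_1)
    have \<Omega>_int: "set_integrable lborel {0..<1} \<Omega>"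
    proof (rule set_integrable_of_Lp_mean_le[OF p \<Omega>_borel])
      show "Lp_mean_le p \<Omega> {0..<1} (exp ((LINT x:arc 0 1|lborel. F x) / 1 + (C + 2 * A)))"
        using key[of 0 1] unfolding arc01 by simp
    qed (simp_all add: \<Omega>F)
    have "Lp_mean_le p \<Omega> (arc a l) (exp (C + 2 * A) * ((LINT x:arc a l|lborel. \<Omega> x) / l))"
      if a: "a \<in> {0..<1}" and l: "l \<in> {0<..1}" for a l
    proof (rule Lp_mean_le_mono[OF p key[OF a l]])
      let ?Q = "arc a l"
      let ?M = "restrict_space lborel ?Q"
      have F_Q: "set_integrable lborel ?Q F"
        using set_integrable_subset[OF F_int[unfolded integrable_circ] _ arc_subset] by simp
      have \<Omega>_Q: "set_integrable lborel ?Q \<Omega>"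
        using set_integrable_subset[OF \<Omega>_int _ arc_subset] by simp
      have \<mu>: "measure ?M (space ?M) = l"
        by (simp add: space_restrict_space measure_restrict_space measure_arc[OF a l])
      have "ennreal (exp ((\<integral>x. F x \<partial>?M) / measure ?M (space ?M)) * measure ?M (space ?M)) \<le> (\<integral>\<^sup>+x. ennreal (exp (F x)) \<partial>?M)"
      proof (rule exp_mean_le)
        show "finite_measure ?M"
          by (rule finite_measureI) (simp add: space_restrict_space emeasure_restrict_space emeasure_arc[OF a l])
        show "0 < measure ?M (space ?M)" using l unfolding \<mu> by simp
        show "integrable ?M F" using F_Q by (simp add: integrable_restrict_space set_integrable_def)
      qed
      also have "\<dots> = ennreal (\<integral>x. \<Omega> x \<partial>?M)"
        using \<Omega>_Q unfolding \<Omega>F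
        by (intro nn_integral_eq_integral) (auto simp: integrable_restrict_space set_integrable_def)
      finally have "exp ((\<integral>x. F x \<partial>?M) / l) * l \<le> (\<integral>x. \<Omega> x \<partial>?M)"
        unfolding \<mu> by (subst (asm) ennreal_le_iff) (auto simp: \<Omega>F intro!: integral_nonneg_AE)
      then have "exp ((LINT x:?Q|lborel. F x) / l) \<le> (LINT x:?Q|lborel. \<Omega> x) / l"
        using l by (simp add: integral_restrict_space set_lebesgue_integral_def field_simps)
      then show "exp ((LINT x:?Q|lborel. F x) / l + (C + 2 * A)) \<le> exp (C + 2 * A) * ((LINT x:?Q|lborel. \<Omega> x) / l)"
        unfolding exp_add[of _ "C + 2 * A"] mult.commute[of _ "exp (C + 2 * A)"] by (rule mult_left_mono) simp
    qed simp
    then show ?case using \<Omega>_int \<Omega>_borel by blast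
  qed simp
qed

section \<open>Back from the Borel representative to the Lebesgue measurable function\<close>

lemma set_integral_lebesgue_cong':
  fixes f g :: "real \<Rightarrow> real"
  assumes [measurable]: "E \<in> sets borel" "g \<in> borel_measurable borel"
    and g: "set_integrable lborel E g" and eq: "AE x in lborel. x \<in> E \<longrightarrow> f x = g x"
  shows "set_integrable lebesgue E f" "(LINT x:E|lebesgue. f x) = (LINT x:E|lborel. g x)"
proof -
  have AE: "AE x in lebesgue. indicat_real E x *\<^sub>R g x = indicat_real E x *\<^sub>R f x"
    using eq unfolding AE_completion_iff by eventually_elim (auto simp: indicator_def)
  have m: "(\<lambda>x. indicat_real E x *\<^sub>R g x) \<in> borel_measurable lborel" by measurable
  \<comment> \<open>Nothing is assumed about the measurability of \<open>f\<close>; it follows from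
    completeness of Lebesgue measure.\<close>
  have fm: "(\<lambda>x. indicat_real E x *\<^sub>R f x) \<in> borel_measurable lebesgue"
    using measurable_completion[OF m] AE by (rule borel_measurable_AE)
  have "integrable lebesgue (\<lambda>x. indicat_real E x *\<^sub>R g x)"
    using g integrable_completion[OF m] by (simp add: set_integrable_def)
  then show int: "set_integrable lebesgue E f"
    unfolding set_integrable_def using fm AE by (rule integrable_cong_AE_imp)
  show "(LINT x:E|lebesgue. f x) = (LINT x:E|lborel. g x)"
    by (rule set_integral_lebesgue_cong(2)[OF assms(1,2) int eq])
qed

lemma RH_le_of_Lp_mean_le:
  assumes p: "1 < p" and C: "0 < C" and w: "\<And>x. 0 \<le> w x" and v: "\<And>x. 0 \<le> v x"
    and [measurable]: "v \<in> borel_measurable borel" and int: "set_integrable lborel {0..<1} v"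
    and eq: "AE x in lborel. x \<in> {0..<1} \<longrightarrow> w x = v x"
    and le: "\<And>a l. a \<in> {0..<1} \<Longrightarrow> l \<in> {0<..1} \<Longrightarrow>
      Lp_mean_le p v (arc a l) (C * ((LINT x:arc a l|lborel. v x) / l))"
  shows "RH_le p w C"
  unfolding RH_le_def
proof (intro conjI ballI)
  show "weight w"
    unfolding weight_def using w set_integral_lebesgue_cong'(1)[OF _ _ int eq] by simp
next
  fix a l :: real assume a: "a \<in> {0..<1}" and l: "l \<in> {0<..1}"
  let ?Q = "arc a l"
  define m where "m = (LINT x:?Q|lborel. v x) / l"
  have eqQ: "AE x in lborel. x \<in> ?Q \<longrightarrow> w x = v x"
    using eq by eventually_elim (use subsetD[OF arc_subset] in blast)
  have avg: "avg ?Q f = (LINT x:?Q|lebesgue. f x) / l" for f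
    by (simp add: avg_def measure_arc[OF a l])
  have vQ: "set_integrable lborel ?Q v" using set_integrable_subset[OF int _ arc_subset] by simp
  have am: "avg ?Q w = m"
    using set_integral_lebesgue_cong'(2)[OF _ _ vQ eqQ] by (simp add: avg m_def)
  have m: "0 \<le> m" using l v by (auto simp: m_def set_lebesgue_integral_def intro!: divide_nonneg_nonneg)
  have leQ: "Lp_mean_le p v ?Q (C * m)" using le[OF a l] by (simp add: m_def)
  show "rh_ineq p ?Q w C"
    using p
  proof (cases rule: ereal_gt_one_cases)
    case inf
    have "AE x in lborel. x \<in> ?Q \<longrightarrow> v x \<le> C * m" using leQ by (simp add: inf Lp_mean_le_def)
    then have "AE x in lborel. x \<in> ?Q \<longrightarrow> w x \<le> C * m" using eqQ by eventually_elim auto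
    then show ?thesis by (simp add: inf rh_ineq_def am AE_completion_iff)
  next
    case (real r)
    have eqr: "AE x in lborel. x \<in> ?Q \<longrightarrow> w x powr r = v x powr r"
      using eqQ by eventually_elim auto
    have nn: "(\<integral>\<^sup>+x\<in>?Q. ennreal (v x powr r) \<partial>lborel) \<le> ennreal ((C * m) powr r * l)"
      using leQ l by (simp add: real Lp_mean_le_def emeasure_arc[OF a l] ennreal_mult)
    have eqi: "(\<integral>\<^sup>+x\<in>?Q. ennreal (v x powr r) \<partial>lborel) = (\<integral>\<^sup>+x. ennreal (indicator ?Q x *\<^sub>R v x powr r) \<partial>lborel)"
      by (intro nn_integral_cong) (auto simp: indicator_def)
    have vr: "set_integrable lborel ?Q (\<lambda>x. v x powr r)"
      unfolding set_integrable_def using nn eqi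
      by (intro integrableI_bounded) (auto simp: order_le_less_trans[OF _ ennreal_less_top])
    have "ennreal (LINT x:?Q|lborel. v x powr r) \<le> ennreal ((C * m) powr r * l)"
      using nn vr unfolding eqi set_lebesgue_integral_def set_integrable_def
      by (subst (asm) nn_integral_eq_integral) auto
    then have *: "(LINT x:?Q|lborel. v x powr r) / l \<le> (C * m) powr r"
      using l by (subst (asm) ennreal_le_iff) (auto simp: field_simps)
    have "avg ?Q (\<lambda>x. w x powr r) = (LINT x:?Q|lborel. v x powr r) / l"
      using set_integral_lebesgue_cong'(2)[OF _ _ vr eqr] by (simp add: avg)
    moreover have "((LINT x:?Q|lborel. v x powr r) / l) powr (1 / r) \<le> ((C * m) powr r) powr (1 / r)"
      using * real l by (intro powr_mono2) (auto simp: set_lebesgue_integral_def intro!: divide_nonneg_nonneg)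
    moreover have "((C * m) powr r) powr (1 / r) = C * m"
      using real C m by (simp add: powr_powr)
    moreover have "set_integrable lebesgue ?Q (\<lambda>x. w x powr r)"
      using set_integral_lebesgue_cong'(1)[OF _ _ vr eqr] by simp
    ultimately show ?thesis by (simp add: real rh_ineq_def am)
  qed
qed

text \<open>\<open>ln\<close> returns a real number at 0 as well, so a finite integral of its
  absolute value does not by itself exclude zeros of \<open>\<omega>\<close>. Positivity almost
  everywhere, implicit in (ii) when log 0 is minus infinity, is therefore stated separately.\<close>

theorem theorem2:
  fixes p :: ereal
  assumes "1 < p"
  shows "\<forall>V::real. \<exists>C::real. \<forall>\<omega> :: real \<Rightarrow> real \<Rightarrow> real.
    (\<forall>t\<in>{0..1}. RHd_le p (\<omega> t) V) \<and>
    (\<lambda>(t, x). \<omega> t x) \<in> borel_measurable (lebesgue_on ({0..1} \<times> {0..1})) \<and>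
    (AE z in lebesgue_on ({0..1} \<times> {0..1}). 0 < \<omega> (fst z) (snd z)) \<and>
    (\<integral>\<^sup>+ z. ennreal \<bar>ln (\<omega> (fst z) (snd z))\<bar> \<partial>lebesgue_on ({0..1} \<times> {0..1})) < \<infinity>
    \<longrightarrow> RH_le p (\<lambda>x. exp (LINT t:{0..1}|lebesgue. ln (\<omega> t (frac (x + t))))) C"
proof
  fix V :: real
  have V2: "2 \<le> max V 2" by simp
  obtain C where C: "0 < C" and core: "\<And>g \<Omega>. \<lbrakk>g \<in> borel_measurable (borel \<Otimes>\<^sub>M borel); \<forall>z. 0 < g z;
      AE t in circ. dyadic_RH p (max V 2) (\<lambda>x. g (t, x));
      (\<integral>\<^sup>+t. (\<integral>\<^sup>+x. ennreal \<bar>ln (g (t, x))\<bar> \<partial>circ) \<partial>circ) < \<infinity>;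
      \<Omega> = (\<lambda>x. exp (\<integral>t. ln (g (t, frac (x + t))) \<partial>circ))\<rbrakk> \<Longrightarrow>
      \<Omega> \<in> borel_measurable borel \<and> set_integrable lborel {0..<1} \<Omega> \<and>
      (\<forall>a\<in>{0..<1}. \<forall>l\<in>{0<..1}. Lp_mean_le p \<Omega> (arc a l) (C * ((LINT x:arc a l|lborel. \<Omega> x) / l)))"
    by (rule geometric_average_RH[OF assms V2]) (rule that)
  show "\<exists>C. \<forall>\<omega>. (\<forall>t\<in>{0..1}. RHd_le p (\<omega> t) V) \<and>
    (\<lambda>(t, x). \<omega> t x) \<in> borel_measurable (lebesgue_on ({0..1} \<times> {0..1})) \<and>
    (AE z in lebesgue_on ({0..1} \<times> {0..1}). 0 < \<omega> (fst z) (snd z)) \<and>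
    (\<integral>\<^sup>+ z. ennreal \<bar>ln (\<omega> (fst z) (snd z))\<bar> \<partial>lebesgue_on ({0..1} \<times> {0..1})) < \<infinity>
    \<longrightarrow> RH_le p (\<lambda>x. exp (LINT t:{0..1}|lebesgue. ln (\<omega> t (frac (x + t))))) C"
  proof (intro exI[of _ C] allI impI, elim conjE)
    fix \<omega> :: "real \<Rightarrow> real \<Rightarrow> real"
    let ?S = "{0..1} \<times> {0..1} :: (real \<times> real) set"
    assume RHd: "\<forall>t\<in>{0..1}. RHd_le p (\<omega> t) V"
      and meas: "(\<lambda>(t, x). \<omega> t x) \<in> borel_measurable (lebesgue_on ?S)"
      and pos: "AE z in lebesgue_on ?S. 0 < \<omega> (fst z) (snd z)"
      and fin: "(\<integral>\<^sup>+ z. ennreal \<bar>ln (\<omega> (fst z) (snd z))\<bar> \<partial>lebesgue_on ?S) < \<infinity>"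
    have S_borel [measurable]: "?S \<in> sets borel"
      by (intro borel_closed closed_Times) auto
    then have S: "?S \<in> sets lebesgue" by auto
    have "(\<lambda>z. if z \<in> ?S then (case z of (t, x) \<Rightarrow> \<omega> t x) else 0) \<in> borel_measurable lebesgue"
      by (rule borel_measurable_if_I[OF meas S])
    from completion_ex_borel_measurable_real[OF this] obtain g0 :: "real \<times> real \<Rightarrow> real"
      where g0 [measurable]: "g0 \<in> borel_measurable borel"
        and g0_eq: "AE z in lborel. (if z \<in> ?S then (case z of (t, x) \<Rightarrow> \<omega> t x) else 0) = g0 z"
      by auto
    \<comment> \<open>Inside the square \<open>g0\<close> fails to be positive only on a null set,
      so the default 1 changes nothing almost everywhere there and makes \<open>g\<close> positive
      on the whole plane.\<close>
    define g where "g z = (if 0 < g0 z then g0 z else 1)" for z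
    have gpos: "\<forall>z. 0 < g z" by (simp add: g_def)
    have g_borel [measurable]: "g \<in> borel_measurable borel" unfolding g_def by measurable
    then have g_pair [measurable]: "g \<in> borel_measurable (borel \<Otimes>\<^sub>M borel)" by (simp add: borel_prod)
    have "AE z in lborel. z \<in> ?S \<longrightarrow> 0 < \<omega> (fst z) (snd z)"
      using pos S by (simp add: AE_restrict_space_iff AE_completion_iff)
    with g0_eq have g_eq: "AE z in lborel. z \<in> ?S \<longrightarrow> \<omega> (fst z) (snd z) = g z"
      by eventually_elim (auto simp: g_def split: if_splits prod.splits)
    \<comment> \<open>Enclosing the exceptional set in a Borel null set makes its sections and its
      image under the shear by rotations measurable.\<close>
    then obtain N where N: "{z \<in> space lborel. \<not> (z \<in> ?S \<longrightarrow> \<omega> (fst z) (snd z) = g z)} \<subseteq> N"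
        "emeasure lborel N = 0" "N \<in> sets lborel" by (rule AE_E)
    have N_eq: "\<omega> t x = g (t, x)" if "(t, x) \<notin> N" "t \<in> {0..1}" "x \<in> {0..1}" for t x
      using subsetD[OF N(1), of "(t, x)"] that by auto
    have N_pair [measurable]: "N \<in> sets (borel \<Otimes>\<^sub>M borel)" unfolding borel_prod using N(3) by simp
    have "AE z in lborel \<Otimes>\<^sub>M lborel. z \<notin> N"
      using N by (intro AE_not_in) (auto simp: lborel_prod null_sets_def)
    from lborel_pair.AE_pair[OF this]
    have "AE t in circ. AE x in circ. (t, x) \<notin> N"
      unfolding AE_circ by eventually_elim (auto elim!: eventually_mono)
    then have good: "AE t in circ. t \<in> {0..1} \<and> (AE x in circ. (t, x) \<notin> N)"
      using AE_space by eventually_elim auto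
    have "AE t in circ. dyadic_RH p (max V 2) (\<lambda>x. g (t, x))"
      using good
    proof eventually_elim
      case (elim t)
      then have t: "t \<in> {0..1}" and "AE x in lborel. x \<in> {0..<1} \<longrightarrow> (t, x) \<notin> N" by (auto simp: AE_circ)
      from this(2) have "AE x in lborel. x \<in> {0..<1} \<longrightarrow> \<omega> t x = g (t, x)"
        by eventually_elim (use N_eq t in auto)
      then show ?case
        using RHd t gpos by (intro RHd_le_imp_dyadic_RH[OF assms]) auto
    qed
    moreover have "(\<integral>\<^sup>+t. (\<integral>\<^sup>+x. ennreal \<bar>ln (g (t, x))\<bar> \<partial>circ) \<partial>circ) < \<infinity>"
    proof -
      have "(\<integral>\<^sup>+t. (\<integral>\<^sup>+x. ennreal \<bar>ln (g (t, x))\<bar> \<partial>circ) \<partial>circ)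
          \<le> (\<integral>\<^sup>+t. (\<integral>\<^sup>+x. ennreal \<bar>ln (g (t, x))\<bar> * indicator ?S (t, x) \<partial>lborel) \<partial>lborel)"
      proof -
        have "(\<integral>\<^sup>+x. ennreal \<bar>ln (g (t, x))\<bar> \<partial>circ) * indicator {0..<1} t
            \<le> (\<integral>\<^sup>+x. ennreal \<bar>ln (g (t, x))\<bar> * indicator ?S (t, x) \<partial>lborel)" for t
        proof (cases "t \<in> {0..<1}")
          case True
          then show ?thesis
            unfolding nn_integral_circ by (auto intro!: nn_integral_mono simp: indicator_def)
        qed simp
        then show ?thesis unfolding nn_integral_circ[of "\<lambda>t. \<integral>\<^sup>+x. ennreal \<bar>ln (g (t, x))\<bar> \<partial>circ"]
          by (intro nn_integral_mono)
      qed
      also have "\<dots> = (\<integral>\<^sup>+z. ennreal \<bar>ln (g z)\<bar> * indicator ?S z \<partial>(lborel \<Otimes>\<^sub>M lborel))"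
        by (rule lborel.nn_integral_fst) (simp add: lborel_prod)
      also have "\<dots> = (\<integral>\<^sup>+z. ennreal \<bar>ln (g z)\<bar> * indicator ?S z \<partial>lborel)" by (simp add: lborel_prod)
      also have "\<dots> = (\<integral>\<^sup>+z. ennreal \<bar>ln (\<omega> (fst z) (snd z))\<bar> * indicator ?S z \<partial>lborel)"
        using g_eq by (intro nn_integral_cong_AE, elim eventually_mono) (auto simp: indicator_def)
      also have "\<dots> = (\<integral>\<^sup>+ z. ennreal \<bar>ln (\<omega> (fst z) (snd z))\<bar> \<partial>lebesgue_on ?S)"
        using S by (simp add: nn_integral_restrict_space nn_integral_completion)
      finally show ?thesis using fin by (rule order_le_less_trans)
    qed
    moreover define \<Omega> where "\<Omega> = (\<lambda>x. exp (\<integral>t. ln (g (t, frac (x + t))) \<partial>circ))"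
    ultimately have \<Omega>: "\<Omega> \<in> borel_measurable borel" "set_integrable lborel {0..<1} \<Omega>"
      "\<And>a l. a \<in> {0..<1} \<Longrightarrow> l \<in> {0<..1} \<Longrightarrow>
        Lp_mean_le p \<Omega> (arc a l) (C * ((LINT x:arc a l|lborel. \<Omega> x) / l))"
      using core[OF g_pair gpos, of \<Omega>] by blast+
    have [measurable]: "(frac :: real \<Rightarrow> real) \<in> borel_measurable borel"
      unfolding frac_def by measurable
    \<comment> \<open>Each rotation preserves null sets, so almost every \<open>t\<close> still
      avoids \<open>N\<close> for almost every \<open>x\<close>. Exchanging the quantifiers gives,
      for almost every \<open>x\<close>, agreement of the two integrands in
      \<open>t\<close>.\<close>
    have "AE t in circ. AE x in circ. (t, frac (x + t)) \<notin> N"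
      using good
    proof eventually_elim
      case (elim t)
      then show ?case using AE_rotation[of t "\<lambda>x. (t, x) \<notin> N"] by blast
    qed
    also have "?this \<longleftrightarrow> (AE x in circ. AE t in circ. (t, frac (x + t)) \<notin> N)"
    proof (rule circ2.AE_commute)
      have "(\<lambda>z. indicat_real N (fst z, frac (snd z + fst z))) \<in> borel_measurable (borel \<Otimes>\<^sub>M borel)" by measurable
      from circ_pair_measurable[OF this]
      have "{z \<in> space (circ \<Otimes>\<^sub>M circ). indicat_real N (fst z, frac (snd z + fst z)) = 0} \<in> sets (circ \<Otimes>\<^sub>M circ)"
        by measurable
      then show "{z \<in> space (circ \<Otimes>\<^sub>M circ). (fst z, frac (snd z + fst z)) \<notin> N} \<in> sets (circ \<Otimes>\<^sub>M circ)"
        by (simp add: indicator_eq_0_iff)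
    qed
    finally have "AE x in circ. exp (LINT t:{0..1}|lebesgue. ln (\<omega> t (frac (x + t)))) = \<Omega> x"
    proof eventually_elim
      case (elim x)
      \<comment> \<open>\<open>?f\<close> includes the end point 1 and \<open>?g\<close> does not,
        so the point 1 is discarded along with the null set of bad \<open>t\<close>.\<close>
      let ?f = "\<lambda>t. indicat_real {0..1} t *\<^sub>R ln (\<omega> t (frac (x + t)))"
      let ?g = "\<lambda>t. indicat_real {0..<1} t *\<^sub>R ln (g (t, frac (x + t)))"
      have m: "?g \<in> borel_measurable lborel" by measurable
      have "AE t in lborel. t \<in> {0..<1} \<longrightarrow> (t, frac (x + t)) \<notin> N" using elim by (simp add: AE_circ)
      then have "AE t in lborel. ?g t = ?f t"
        using AE_lborel_singleton[of 1]
      proof eventually_elim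
        case (elim t)
        have "frac (x + t) \<in> {0..1}" using frac_lt_1[of "x + t"] by (simp add: less_imp_le)
        then show ?case using elim N_eq[of t "frac (x + t)"] by (auto simp: indicator_def)
      qed
      then have AE: "AE t in lebesgue. ?g t = ?f t" by (simp add: AE_completion_iff)
      have fm: "?f \<in> borel_measurable lebesgue"
        using measurable_completion[OF m] AE by (rule borel_measurable_AE)
      have "(\<integral>t. ?g t \<partial>lebesgue) = (\<integral>t. ?f t \<partial>lebesgue)"
        by (rule integral_cong_AE[OF measurable_completion[OF m] fm AE])
      then show ?case
        using integral_completion[OF m] by (simp add: \<Omega>_def integral_circ set_lebesgue_integral_def)
    qed
    then have "AE x in lborel. x \<in> {0..<1} \<longrightarrow> exp (LINT t:{0..1}|lebesgue. ln (\<omega> t (frac (x + t)))) = \<Omega> x"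
      by (simp add: AE_circ)
    then show "RH_le p (\<lambda>x. exp (LINT t:{0..1}|lebesgue. ln (\<omega> t (frac (x + t))))) C"
      using \<Omega> by (intro RH_le_of_Lp_mean_le[OF assms C, where v=\<Omega>]) (auto simp: \<Omega>_def)
  qed
qed

end
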